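(* Let $n\ge 2$ and let $F$ be a holomorphic function of $n$ variables. The second Jacobian ideal $\mathcal{J}_2(F)$ admits the decomposition \[ \mathcal{J}_2(F) = \mathcal{J}_1(F)^{n+1} + \mathcal{J}_1(F)^{n-2}\,\mathcal{Q}(F). \]
   Context: Let $F$ be holomorphic on an open subset of $\mathbb{C}^n$ with coordinates $x_1,\dots,x_n$. Ideals are taken in the ring of holomorphic functions on the domain of $F$. Write $f_k=\partial F/\partial x_k$ and $f_{ij}=\partial^2F/\partial x_i\partial x_j$. The second Jacobian matrix $\mathrm{Jac}_2(F)$ is the $(n+1)\times\left(n+\binom{n+1}{2}\right)$ matrix with rows labeled $\beta_0,\beta_1,\dots,\beta_n$ and columns labeled $\beta_{ij}$ for $0\le i\le j\le n$, $(i,j)\ne(0,0)$, ordered as $\beta_{01},\dots,\beta_{0n},\beta_{11},\dots,\beta_{1n},\beta_{22},\dots,\beta_{(n-1)n},\beta_{nn}$. Its entries are as follows. Row $\beta_0$: the entry in column $\beta_{0j}$ is $f_j$, in column $\beta_{ii}$ ($i\ge1$) is $\frac12 f_{ii}$, and in column $\beta_{ij}$ ($1\le i<j$) is $f_{ij}$. Row $\beta_k$ with $k\ge1$: the entry in column $\beta_{0j}$ is $0$; the entry in column $\beta_{ij}$ ($1\le i\le j$) is $f_j$ if $k=i$, is $f_i$ if $k=j$, and is $0$ otherwise. The second Jacobian ideal $\mathcal{J}_2(F)$ is the ideal generated by the maximal minors of $\mathrm{Jac}_2(F)$. The Jacobian ideal is $\mathcal{J}_1(F)=(f_1,\dots,f_n)$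 (and $\mathcal{J}_1(F)^0$ is the unit ideal). For $1\le i,j,k,l\le n$ put \[Q_{ij;kl}(F) = f_{ik}f_jf_l - f_{jk}f_if_l - f_{il}f_jf_k + f_{jl}f_if_k,\] and let $\mathcal{Q}(F)$ be the ideal generated by all $Q_{ij;kl}(F)$, $1\le i,j,k,l\le n$. *)

theory Defs
  imports
    "HOL-Analysis.Analysis"
    "HOL-Algebra.Ideal_Product"
    "Jordan_Normal_Form.Determinant"
    "Jordan_Normal_Form.DL_Submatrix"
begin

section \<open>Holomorphic functions of several variables\<close>

text \<open>Complex Frechet differentiability: \<^const>\<open>has_derivative\<close> only supplies a real-linear
  derivative, so complex homogeneity is demanded in addition. It is only used for open \<open>U\<close>.\<close>

definition holomorphic_multi :: "(complex ^ 'n \<Rightarrow> complex) \<Rightarrow> (complex ^ 'n) set \<Rightarrow> bool" where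
  "holomorphic_multi F U \<longleftrightarrow>
     (\<forall>x\<in>U. \<exists>D. (F has_derivative D) (at x) \<and> (\<forall>c v. D (c *s v) = c * D v))"

text \<open>Elements of the ring are made extensional (\<open>undefined\<close> off \<open>U\<close>), so that equality in the
  carrier is equality on \<open>U\<close>.\<close>

definition holo_ring :: "(complex ^ 'n) set \<Rightarrow> (complex ^ 'n \<Rightarrow> complex) ring" where
  "holo_ring U =
     \<lparr> carrier = {f \<in> extensional U. holomorphic_multi f U},
       mult = (\<lambda>f g. \<lambda>x\<in>U. f x * g x),
       one = (\<lambda>x\<in>U. 1),
       zero = (\<lambda>x\<in>U. 0),
       add = (\<lambda>f g. \<lambda>x\<in>U. f x + g x) \<rparr>"

section \<open>Partial derivatives\<close>

text \<open>Throughout, a bijection \<open>idx\<close> from \<open>{1..n}\<close> onto the finite index type \<open>'n\<close> names the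
  coordinates: the \<open>k\<close>-th coordinate of \<open>x\<close> is the component of \<open>x\<close> at \<open>idx k\<close>.\<close>

definition partial :: "(nat \<Rightarrow> 'n) \<Rightarrow> nat \<Rightarrow> (complex ^ 'n \<Rightarrow> complex) \<Rightarrow> complex ^ 'n \<Rightarrow> complex" where
  "partial idx k F = (\<lambda>x. deriv (\<lambda>t. F (x + axis (idx k) t)) 0)"

definition partial2 ::
  "(nat \<Rightarrow> 'n) \<Rightarrow> nat \<Rightarrow> nat \<Rightarrow> (complex ^ 'n \<Rightarrow> complex) \<Rightarrow> complex ^ 'n \<Rightarrow> complex" where
  "partial2 idx i j F = partial idx i (partial idx j F)"

section \<open>The second Jacobian matrix\<close>

definition jac2_cols :: "nat \<Rightarrow> (nat \<times> nat) list" where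
  "jac2_cols n = [(i, j). i \<leftarrow> [0..<Suc n], j \<leftarrow> [i..<Suc n], (i, j) \<noteq> (0, 0)]"

fun jac2_entry ::
  "(nat \<Rightarrow> 'n) \<Rightarrow> (complex ^ 'n \<Rightarrow> complex) \<Rightarrow> nat \<Rightarrow> nat \<times> nat \<Rightarrow> complex ^ 'n \<Rightarrow> complex" where
  "jac2_entry idx F k (i, j) x =
     (if k = 0 then
        (if i = 0 then partial idx j F x
         else if i = j then 1 / 2 * partial2 idx i i F x
         else partial2 idx i j F x)
      else if i = 0 then 0
      else if k = i then partial idx j F x
      else if k = j then partial idx i F x
      else 0)"

definition jac2 ::
  "nat \<Rightarrow> (nat \<Rightarrow> 'n) \<Rightarrow> (complex ^ 'n \<Rightarrow> complex) \<Rightarrow> complex ^ 'n \<Rightarrow> complex mat" where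
  "jac2 n idx F x =
     mat (n + 1) (n + ((n + 1) choose 2)) (\<lambda>(r, c). jac2_entry idx F r (jac2_cols n ! c) x)"

section \<open>The ideals\<close>

text \<open>In each case the generators are holomorphic on \<open>U\<close> when \<open>F\<close> is and \<open>U\<close> is open; restricting
  them to \<open>U\<close> puts them into the carrier of \<^term>\<open>holo_ring U\<close>.\<close>

definition jacobian_ideal ::
  "nat \<Rightarrow> (nat \<Rightarrow> 'n) \<Rightarrow> (complex ^ 'n) set \<Rightarrow> (complex ^ 'n \<Rightarrow> complex) \<Rightarrow> (complex ^ 'n \<Rightarrow> complex) set" where
  "jacobian_ideal n idx U F =
     Idl\<^bsub>holo_ring U\<^esub> {restrict (partial idx k F) U | k. k \<in> {1..n}}"

text \<open>A maximal minor is determined by the set \<open>J\<close> of positions of its \<open>n + 1\<close> columns.\<close>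

definition second_jacobian_ideal ::
  "nat \<Rightarrow> (nat \<Rightarrow> 'n) \<Rightarrow> (complex ^ 'n) set \<Rightarrow> (complex ^ 'n \<Rightarrow> complex) \<Rightarrow> (complex ^ 'n \<Rightarrow> complex) set" where
  "second_jacobian_ideal n idx U F =
     Idl\<^bsub>holo_ring U\<^esub>
       {(\<lambda>x\<in>U. Determinant.det (submatrix (jac2 n idx F x) UNIV J)) | J.
          J \<subseteq> {..<n + ((n + 1) choose 2)} \<and> card J = n + 1}"

definition Q_fun ::
  "(nat \<Rightarrow> 'n) \<Rightarrow> (complex ^ 'n \<Rightarrow> complex) \<Rightarrow> nat \<Rightarrow> nat \<Rightarrow> nat \<Rightarrow> nat \<Rightarrow> complex ^ 'n \<Rightarrow> complex" where
  "Q_fun idx F i j k l x =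
     partial2 idx i k F x * partial idx j F x * partial idx l F x
     - partial2 idx j k F x * partial idx i F x * partial idx l F x
     - partial2 idx i l F x * partial idx j F x * partial idx k F x
     + partial2 idx j l F x * partial idx i F x * partial idx k F x"

definition Q_ideal ::
  "nat \<Rightarrow> (nat \<Rightarrow> 'n) \<Rightarrow> (complex ^ 'n) set \<Rightarrow> (complex ^ 'n \<Rightarrow> complex) \<Rightarrow> (complex ^ 'n \<Rightarrow> complex) set" where
  "Q_ideal n idx U F =
     Idl\<^bsub>holo_ring U\<^esub>
       {restrict (Q_fun idx F i j k l) U | i j k l.
          i \<in> {1..n} \<and> j \<in> {1..n} \<and> k \<in> {1..n} \<and> l \<in> {1..n}}"

text \<open>The library has no separate power of ideals: it is the power in the semiring
  \<^const>\<open>ideals_set\<close> of ideals of \<open>R\<close>, whose unit is the unit ideal \<^term>\<open>carrier R\<close>.\<close>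

abbreviation ideal_power :: "('a, 'b) ring_scheme \<Rightarrow> 'a set \<Rightarrow> nat \<Rightarrow> 'a set" where
  "ideal_power R I k \<equiv> I [^]\<^bsub>ideals_set R\<^esub> k"

end

(*
  Pointwise everything depends on the vector y = (f_1, ..., f_n) and the symmetric matrix h = (f_ij).
  Expanding a maximal minor along its top row gives h |-> sum_ij u_ij(y) h_ij (up to terms in f_j times
  degree n), where u is a symmetric matrix of forms of degree n with u(y) y = 0: replacing the top row by
  another row makes the determinant vanish.  In characteristic 0 such a u is a combination, with
  coefficients of degree n - 2, of the tensors defining the Q_ij;kl; the coefficients are second
  derivatives of u (Euler's identity).  This gives one inclusion.

  Conversely, columns (v, p v), v = 1..n, with p idempotent, together with a column (0, j) or (i, j),
  give every monomial of degree n + 1 and every monomial of degree n - 2 times Q_ij;ij.  The span of all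
  minors is invariant under the linear substitutions y_i |-> y_i + y_k, which polarise Q_ij;ij to
  Q_ij;kl + Q_il;kj, and the Bianchi identity recovers Q_ij;kl.
*)

theory Submission
  imports Defs "HOL-Complex_Analysis.Complex_Analysis"
begin

text \<open>Symmetry of h carries much of the argument: the Bianchi identity fails for general h,
  and a column pair may be reordered only when h_ij = h_ji. So second partials must commute and must
  themselves be holomorphic; both are drawn from Cauchy's formula for a derivative.

  The obstacle in the converse inclusion is that forests with one extra column yield only Q_ij;ij,
  while the ideal needs Q with three or four distinct indices. Instead of searching for further
  minors, the proof lets linear substitutions act on y and h together. For this to map minors to
  sums of minors, a column has to be bilinear in its two indices. Hence the minors are taken over
  arbitrary sequences of ordered pairs, with the column (i, i) doubled; order, repetitions and
  powers of 2 are removed only when the actual generators of the second Jacobian ideal appear.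

  Division by integers is essential in the other inclusion: a symmetric syzygy of degree d is
  recovered from its second derivatives up to the factor 4 d (d + 1).\<close>

section \<open>Partial derivatives of holomorphic functions\<close>

definition pd :: "'n \<Rightarrow> (complex ^ 'n::finite \<Rightarrow> complex) \<Rightarrow> complex ^ 'n \<Rightarrow> complex" where
  "pd k F = (\<lambda>x. deriv (\<lambda>t. F (x + axis k t)) 0)"

lemma partial_eq_pd: "partial idx k F = pd (idx k) F"
  by (simp add: partial_def pd_def)

lemma norm_axis: "norm (axis k x :: complex ^ 'n::finite) = norm x"
  by (simp add: norm_vec_def L2_set_def axis_def if_distrib[of norm] if_distrib[of "\<lambda>x. x\<^sup>2"] cong: if_cong)

lemma bounded_linear_axis: "bounded_linear (axis k :: complex \<Rightarrow> complex ^ 'n::finite)"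
proof (rule bounded_linear_intro)
  show "axis k (x + y) = axis k x + axis k y" for x y :: complex
    by (simp add: axis_def Finite_Cartesian_Product.vec_eq_iff)
  show "axis k (r *\<^sub>R x) = r *\<^sub>R axis k x" for r and x :: complex
    by (simp add: axis_def Finite_Cartesian_Product.vec_eq_iff)
  show "norm (axis k x :: complex ^ 'n) \<le> norm x * 1" for x :: complex
    by (simp add: norm_axis)
qed

lemma axis_zero: "axis k 0 = (0 :: complex ^ 'n::finite)"
  by (simp add: axis_def Finite_Cartesian_Product.vec_eq_iff)

lemma axis_eq_scaled: "axis k t = t *s (axis k 1 :: complex ^ 'n::finite)"
  by (simp add: axis_def Finite_Cartesian_Product.vec_eq_iff)

lemma holomorphic_multi_line:
  fixes F :: "complex ^ 'n::finite \<Rightarrow> complex"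
  assumes D: "(F has_derivative D) (at (x + axis k t))" and hom: "\<And>c v. D (c *s v) = c * D v"
  shows "((\<lambda>t. F (x + axis k t)) has_field_derivative D (axis k 1)) (at t)"
proof -
  have "((\<lambda>t. x + axis k t) has_derivative axis k) (at t)"
    using bounded_linear.has_derivative[OF bounded_linear_axis has_derivative_ident]
    by (auto intro!: derivative_eq_intros)
  from diff_chain_at[OF this D]
  have "((\<lambda>t. F (x + axis k t)) has_derivative (\<lambda>s. D (axis k s))) (at t)"
    by (simp add: o_def)
  moreover have "(\<lambda>s. D (axis k s)) = (*) (D (axis k 1))"
    by (subst axis_eq_scaled) (simp add: hom mult.commute fun_eq_iff)
  ultimately show ?thesis
    by (simp add: has_field_derivative_def)
qed

lemma holomorphic_multi_pd:
  fixes F :: "complex ^ 'n::finite \<Rightarrow> complex"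
  assumes D: "(F has_derivative D) (at x)" and hom: "\<And>c v. D (c *s v) = c * D v"
  shows "pd k F x = D (axis k 1)"
  unfolding pd_def
  using holomorphic_multi_line[of F D x k 0] assms by (auto intro!: DERIV_imp_deriv simp: axis_zero)

lemma vec_sum_axis: "v = (\<Sum>k\<in>UNIV. (v $ k) *s (axis k 1 :: complex ^ 'n::finite))"
  by (simp add: Finite_Cartesian_Product.vec_eq_iff axis_def if_distrib cong: if_cong)

text \<open>The vectors \<open>axis k 1\<close> form a basis only over the complex numbers, so it is
  complex homogeneity that makes the partials determine the derivative.\<close>

lemma holomorphic_multi_derivative:
  fixes F :: "complex ^ 'n::finite \<Rightarrow> complex"
  assumes "holomorphic_multi F U" "x \<in> U"
  shows "(F has_derivative (\<lambda>v. \<Sum>k\<in>UNIV. v $ k * pd k F x)) (at x)"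
proof -
  obtain D where D: "(F has_derivative D) (at x)" and hom: "\<And>c v. D (c *s v) = c * D v"
    using assms unfolding holomorphic_multi_def by blast
  have lin: "linear D" using D has_derivative_linear by blast
  have "D v = (\<Sum>k\<in>UNIV. v $ k * pd k F x)" for v
    by (subst vec_sum_axis) (simp add: linear_sum[OF lin] hom holomorphic_multi_pd[OF D hom])
  then have "D = (\<lambda>v. \<Sum>k\<in>UNIV. v $ k * pd k F x)" by blast
  with D show ?thesis by simp
qed

lemma holomorphic_multi_continuous_on:
  assumes "holomorphic_multi F U" shows "continuous_on U F"
  using assms unfolding holomorphic_multi_def
  by (meson continuous_at_imp_continuous_on has_derivative_continuous)

section \<open>Cauchy's formula and differentiation under the integral\<close>

definition circ :: "real \<Rightarrow> real \<Rightarrow> complex" where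
  "circ r t = of_real r * exp (2 * of_real pi * \<i> * of_real t)"

lemma norm_circ: "norm (circ r t) = \<bar>r\<bar>"
  by (simp add: circ_def norm_mult norm_exp_eq_Re)

lemma circ_nonzero: "r > 0 \<Longrightarrow> circ r t \<noteq> 0"
  by (simp add: circ_def)

lemma continuous_on_circ [continuous_intros]:
  "continuous_on A g \<Longrightarrow> continuous_on A (\<lambda>x. circ r (g x))"
  unfolding circ_def by (intro continuous_intros)

text \<open>Cauchy's formula for a first derivative, where the speed of the circle cancels one of
  the two factors in the denominator. The path is a translate of one fixed circle, so x enters only
  through F and the integral can be differentiated in x.\<close>

lemma pd_has_integral:
  fixes F :: "complex ^ 'n::finite \<Rightarrow> complex"
  assumes F: "holomorphic_multi F U" and U: "cball x r \<subseteq> U" and r: "r > 0"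
  shows "((\<lambda>t. F (x + axis k (circ r t)) / circ r t) has_integral pd k F x) {0..1}"
proof -
  let ?f = "\<lambda>s. F (x + axis k s)"
  have mem: "x + axis k s \<in> U" if "s \<in> cball 0 r" for s
    using that U by (auto simp: subset_iff dist_norm norm_axis)
  have "\<exists>f'. (?f has_field_derivative f') (at s)" if "s \<in> cball 0 r" for s
    using F mem[OF that] holomorphic_multi_line unfolding holomorphic_multi_def by blast
  then have hol: "?f holomorphic_on cball 0 r"
    by (meson DERIV_subset field_differentiable_def holomorphic_on_def subset_UNIV)
  have "((\<lambda>u. ?f u / (u - 0) ^ Suc 1) has_contour_integral
      ((2 * pi * \<i>) / (fact 1) * (deriv ^^ 1) ?f 0)) (circlepath 0 r)"
    using hol r holomorphic_on_subset[OF hol ball_subset_cball]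
    by (intro Cauchy_has_contour_integral_higher_derivative_circlepath)
       (auto simp: holomorphic_on_imp_continuous_on)
  then have int: "((\<lambda>t. ?f (circlepath 0 r t) / (circlepath 0 r t - 0) ^ Suc 1
      * vector_derivative (circlepath 0 r) (at t within {0..1})) has_integral (2 * pi * \<i>) * pd k F x) {0..1}"
    by (simp add: has_contour_integral_def pd_def)
  have "((\<lambda>t. ?f (circ r t) / (circ r t)^2 * (2 * pi * \<i> * circ r t)) has_integral
       (2 * pi * \<i>) * pd k F x) {0..1}"
  proof (rule has_integral_eq[OF _ int])
    fix t :: real assume t: "t \<in> {0..1}"
    have "circlepath 0 r t = circ r t"
      by (simp add: circlepath circ_def)
    moreover have "vector_derivative (circlepath 0 r) (at t within {0..1}) = 2 * pi * \<i> * circ r t"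
      using t by (simp add: vector_derivative_circlepath01 circ_def)
    ultimately show "?f (circlepath 0 r t) / (circlepath 0 r t - 0) ^ Suc 1
      * vector_derivative (circlepath 0 r) (at t within {0..1}) = ?f (circ r t) / (circ r t)^2 * (2 * pi * \<i> * circ r t)"
      by (simp add: power2_eq_square)
  qed
  then have "((\<lambda>t. ?f (circ r t) / (circ r t)^2 * (2 * pi * \<i> * circ r t) * (1 / (2 * pi * \<i>))) has_integral
       (2 * pi * \<i>) * pd k F x * (1 / (2 * pi * \<i>))) {0..1}"
    by (rule has_integral_mult_left)
  moreover have "?f (circ r t) / (circ r t)^2 * (2 * pi * \<i> * circ r t) * (1 / (2 * pi * \<i>)) = ?f (circ r t) / circ r t" for t
    using circ_nonzero[OF r] by (simp add: field_simps power2_eq_square)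
  ultimately show ?thesis by simp
qed

lemma continuous_on_circ_param:
  fixes G :: "complex ^ 'n::finite \<Rightarrow> complex"
  assumes G: "continuous_on U G" and V: "\<And>y. y \<in> V \<Longrightarrow> cball y r \<subseteq> U" and r: "r > 0"
  shows "continuous_on (V \<times> cbox 0 1) (\<lambda>(y, t). G (y + axis k (circ r t)) / circ r t)"
proof -
  have "(\<lambda>(y, t). y + axis k (circ r t)) ` (V \<times> cbox 0 1) \<subseteq> U"
  proof safe
    fix y t assume "y \<in> V"
    then show "y + axis k (circ r t) \<in> U"
      using V[of y] r by (auto simp: subset_iff dist_norm norm_axis norm_circ norm_mult)
  qed
  moreover have "continuous_on (V \<times> cbox 0 1) (\<lambda>(y, t). y + axis k (circ r t))"
    by (auto simp: case_prod_unfold intro!: continuous_intros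
        continuous_on_compose2[OF linear_continuous_on[OF bounded_linear_axis]])
  ultimately have "continuous_on (V \<times> cbox 0 1) (\<lambda>z. G ((\<lambda>(y, t). y + axis k (circ r t)) z))"
    by (intro continuous_on_compose2[OF G])
  then show ?thesis
    using circ_nonzero[OF r] by (auto simp: case_prod_unfold intro!: continuous_intros)
qed

text \<open>One radius serves all centres near x, so near x a partial derivative is an integral with
  a fixed kernel over a fixed domain.\<close>

lemma cball_nbhd:
  fixes x :: "complex ^ 'n::finite"
  assumes "open U" "x \<in> U"
  obtains r where "r > 0" "\<And>y. y \<in> ball x r \<Longrightarrow> cball y r \<subseteq> U"
proof -
  obtain e where e: "e > 0" "ball x e \<subseteq> U" using assms open_contains_ball by blast
  have "cball y (e/2) \<subseteq> U" if "y \<in> ball x (e/2)" for y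
  proof
    fix z assume "z \<in> cball y (e/2)"
    with that have "dist x z < e" using dist_triangle[of x z y] by auto
    with e show "z \<in> U" by auto
  qed
  with e show ?thesis by (intro that[of "e/2"]) auto
qed

text \<open>Differentiating the integral needs jointly continuous partials of the integrand. Their
  continuity is obtained first, from an integral that involves only F.\<close>

lemma continuous_on_pd:
  fixes F :: "complex ^ 'n::finite \<Rightarrow> complex"
  assumes F: "holomorphic_multi F U" and U: "open U"
  shows "continuous_on U (pd k F)"
proof (rule continuous_at_imp_continuous_on, rule ballI)
  fix x assume "x \<in> U"
  then obtain r where r: "r > 0" "\<And>y. y \<in> ball x r \<Longrightarrow> cball y r \<subseteq> U"
    using cball_nbhd[OF U] by blast
  have "continuous_on (ball x r) (\<lambda>y. integral (cbox 0 1) (\<lambda>t. F (y + axis k (circ r t)) / circ r t))"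
    by (intro integral_continuous_on_param continuous_on_circ_param[OF holomorphic_multi_continuous_on[OF F] r(2) r(1)])
  moreover have "integral (cbox 0 1) (\<lambda>t. F (y + axis k (circ r t)) / circ r t) = pd k F y" if "y \<in> ball x r" for y
    using pd_has_integral[OF F r(2) r(1)] that by (simp add: integral_unique)
  ultimately have "continuous_on (ball x r) (pd k F)"
    by (rule continuous_on_eq)
  then show "isCont (pd k F) x"
    using r by (simp add: continuous_on_eq_continuous_at)
qed

text \<open>The rule for differentiating parameter integrals expects the derivative as a bounded
  linear function that varies continuously; this packages a gradient in that form.\<close>

definition lin_form :: "('n \<Rightarrow> complex) \<Rightarrow> (complex ^ 'n::finite) \<Rightarrow>\<^sub>L complex" where
  "lin_form a = Blinfun (\<lambda>v. \<Sum>k\<in>UNIV. v $ k * a k)"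

lemma lin_form_apply: "blinfun_apply (lin_form a) v = (\<Sum>k\<in>UNIV. v $ k * a k)"
  unfolding lin_form_def
  by (subst bounded_linear_Blinfun_apply)
     (auto intro!: bounded_linear_sum bounded_linear_mult_const bounded_linear_vec_nth)

lemma pd_has_derivative:
  fixes F :: "complex ^ 'n::finite \<Rightarrow> complex"
  assumes F: "holomorphic_multi F U" and U: "open U" "x \<in> U"
    and r: "r > 0" "\<And>y. y \<in> ball x r \<Longrightarrow> cball y r \<subseteq> U"
  shows "(pd k F has_derivative
     (\<lambda>v. integral (cbox 0 1) (\<lambda>t. \<Sum>j\<in>UNIV. v $ j * (pd j F (x + axis k (circ r t)) / circ r t)))) (at x)"
proof -
  let ?L = "\<lambda>y t. lin_form (\<lambda>j. pd j F (y + axis k (circ r t)) / circ r t)"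
  have cont: "continuous_on (ball x r \<times> cbox 0 1) (\<lambda>(y, t). ?L y t)"
  proof (rule continuous_on_blinfun_componentwise)
    fix i :: "complex ^ 'n"
    have "continuous_on (ball x r \<times> cbox 0 1) (\<lambda>z. \<Sum>j\<in>UNIV. i $ j *
       (case z of (y, t) \<Rightarrow> pd j F (y + axis k (circ r t)) / circ r t))"
      by (intro continuous_intros continuous_on_circ_param[OF continuous_on_pd[OF F U(1)] r(2) r(1)])
    then show "continuous_on (ball x r \<times> cbox 0 1) (\<lambda>z. blinfun_apply (case z of (y, t) \<Rightarrow> ?L y t) i)"
      by (simp add: case_prod_unfold lin_form_apply)
  qed
  have der: "((\<lambda>y. integral (cbox 0 1) (\<lambda>t. F (y + axis k (circ r t)) / circ r t)) has_derivative
      integral (cbox 0 1) (?L x)) (at x within ball x r)"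
  proof (rule leibniz_rule)
    fix y t assume y: "y \<in> ball x r"
    have "y + axis k (circ r t) \<in> U"
      using r y by (auto simp: subset_iff dist_norm norm_axis norm_circ norm_mult)
    note D = holomorphic_multi_derivative[OF F this]
    have eqL: "blinfun_apply (?L y t) = (\<lambda>v. (\<Sum>j\<in>UNIV. v $ j * pd j F (y + axis k (circ r t))) / circ r t)"
      by (simp add: fun_eq_iff lin_form_apply sum_divide_distrib)
    have "((\<lambda>y. y + axis k (circ r t)) has_derivative (\<lambda>v. v)) (at y)"
      by (auto intro!: derivative_eq_intros)
    from has_derivative_compose[OF this D]
    have "((\<lambda>y. F (y + axis k (circ r t))) has_derivative (\<lambda>v. \<Sum>j\<in>UNIV. v $ j * pd j F (y + axis k (circ r t)))) (at y)" .
    then have "((\<lambda>y. F (y + axis k (circ r t)) / circ r t) has_derivative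
        (\<lambda>v. (\<Sum>j\<in>UNIV. v $ j * pd j F (y + axis k (circ r t))) / circ r t)) (at y)"
      by (rule bounded_linear.has_derivative[OF bounded_linear_divide])
    then show "((\<lambda>y. F (y + axis k (circ r t)) / circ r t) has_derivative blinfun_apply (?L y t)) (at y within ball x r)"
      unfolding eqL by (rule has_derivative_at_withinI)
  next
    fix y assume y: "y \<in> ball x r"
    show "(\<lambda>t. F (y + axis k (circ r t)) / circ r t) integrable_on cbox 0 1"
      using pd_has_integral[OF F r(2)[OF y] r(1)] by auto
  qed (use cont r in auto)
  have int: "?L x integrable_on cbox 0 1"
  proof (rule integrable_continuous)
    have "continuous_on (cbox 0 1) (\<lambda>t. (case (x, t) of (y, t) \<Rightarrow> ?L y t))"
      using r(1) by (intro continuous_on_compose2[OF cont]) (auto intro!: continuous_intros)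
    then show "continuous_on (cbox 0 1) (?L x)" by simp
  qed
  have "blinfun_apply (integral (cbox 0 1) (?L x)) v =
      integral (cbox 0 1) (\<lambda>t. \<Sum>j\<in>UNIV. v $ j * (pd j F (x + axis k (circ r t)) / circ r t))" for v
    unfolding blinfun_apply_integral[OF int] lin_form_apply ..
  then have eq: "blinfun_apply (integral (cbox 0 1) (?L x)) =
      (\<lambda>v. integral (cbox 0 1) (\<lambda>t. \<Sum>j\<in>UNIV. v $ j * (pd j F (x + axis k (circ r t)) / circ r t)))"
    by blast
  have "(pd k F has_derivative integral (cbox 0 1) (?L x)) (at x within ball x r)"
  proof (rule has_derivative_transform[OF _ _ der])
    show "pd k F y = integral (cbox 0 1) (\<lambda>t. F (y + axis k (circ r t)) / circ r t)" if "y \<in> ball x r" for y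
      using integral_unique[OF pd_has_integral[OF F r(2)[OF that] r(1), of k]] by simp
  qed (use r(1) in simp)
  then show ?thesis
    using at_within_open[of x "ball x r"] r(1) unfolding eq by simp
qed

text \<open>The integral formula for the derivative is complex homogeneous because v enters it only
  through its complex coordinates.\<close>

lemma holomorphic_multi_pd_closed:
  fixes F :: "complex ^ 'n::finite \<Rightarrow> complex"
  assumes F: "holomorphic_multi F U" and U: "open U"
  shows "holomorphic_multi (pd k F) U"
  unfolding holomorphic_multi_def
proof
  fix x assume x: "x \<in> U"
  then obtain r where r: "r > 0" "\<And>y. y \<in> ball x r \<Longrightarrow> cball y r \<subseteq> U"
    using cball_nbhd[OF U] by blast
  let ?D = "\<lambda>v. integral (cbox 0 1) (\<lambda>t. \<Sum>j\<in>UNIV. v $ j * (pd j F (x + axis k (circ r t)) / circ r t))"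
  have "?D (c *s v) = c * ?D v" for c v
    by (simp add: mult.assoc times_divide_eq_right[symmetric] del: times_divide_eq_right flip: sum_distrib_left integral_mult_right)
  with pd_has_derivative[OF F U x r, of k]
  show "\<exists>D. (pd k F has_derivative D) (at x) \<and> (\<forall>c v. D (c *s v) = c * D v)" by blast
qed

lemma sum_axis_mult: "(\<Sum>i\<in>UNIV. (axis j 1 :: complex ^ 'n::finite) $ i * a i) = a j"
proof -
  have "(\<Sum>i\<in>UNIV. (axis j 1 :: complex ^ 'n) $ i * a i) = (\<Sum>i\<in>UNIV. if i = j then a i else 0)"
    by (intro sum.cong) (auto simp: axis_def)
  then show ?thesis by simp
qed

text \<open>Taken in direction j, the derivative of \<open>pd k F\<close> passes under the integral
  and falls on F. What remains is Cauchy's formula in direction k for \<open>pd j F\<close>.\<close>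

lemma pd_commute:
  fixes F :: "complex ^ 'n::finite \<Rightarrow> complex"
  assumes F: "holomorphic_multi F U" and U: "open U" and x: "x \<in> U"
  shows "pd j (pd k F) x = pd k (pd j F) x"
proof -
  obtain r where r: "r > 0" "\<And>y. y \<in> ball x r \<Longrightarrow> cball y r \<subseteq> U"
    using cball_nbhd[OF U x] by blast
  define D where "D = (\<lambda>v :: complex ^ 'n. integral (cbox 0 1) (\<lambda>t. \<Sum>j\<in>UNIV. v $ j * (pd j F (x + axis k (circ r t)) / circ r t)))"
  have der: "(pd k F has_derivative D) (at x)"
    unfolding D_def by (rule pd_has_derivative[OF F U x r])
  have "D (c *s v) = c * D v" for c v
    by (simp add: D_def mult.assoc times_divide_eq_right[symmetric] del: times_divide_eq_right flip: sum_distrib_left integral_mult_right)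
  then have "pd j (pd k F) x = D (axis j 1)"
    by (rule holomorphic_multi_pd[OF der])
  also have "\<dots> = integral (cbox 0 1) (\<lambda>t. pd j F (x + axis k (circ r t)) / circ r t)"
    by (simp only: D_def sum_axis_mult)
  also have "\<dots> = pd k (pd j F) x"
  proof -
    have "((\<lambda>t. pd j F (x + axis k (circ r t)) / circ r t) has_integral pd k (pd j F) x) {0..1}"
      by (rule pd_has_integral[OF holomorphic_multi_pd_closed[OF F U] r(2) r(1)]) (use r(1) in simp)
    then show ?thesis by (simp add: integral_unique)
  qed
  finally show ?thesis .
qed

section \<open>Homogeneous polynomial functions\<close>

declare One_nat_def [simp del]

text \<open>Polynomials are represented by their functions, so identities are pointwise and
  derivatives are analytic. The rules mirror powers of an ideal: constants belong to the zeroth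
  power, and a factor \<open>y k\<close> raises the exponent by one.\<close>

inductive hom_poly :: "nat \<Rightarrow> nat \<Rightarrow> ((nat \<Rightarrow> complex) \<Rightarrow> complex) \<Rightarrow> bool" for n :: nat where
  const: "hom_poly n 0 (\<lambda>_. c)"
| zero: "hom_poly n d (\<lambda>_. 0)"
| add: "hom_poly n d p \<Longrightarrow> hom_poly n d q \<Longrightarrow> hom_poly n d (\<lambda>y. p y + q y)"
| times: "k \<in> {1..n} \<Longrightarrow> hom_poly n d p \<Longrightarrow> hom_poly n (Suc d) (\<lambda>y. y k * p y)"

lemma hom_poly_scale: "hom_poly n d p \<Longrightarrow> hom_poly n d (\<lambda>y. c * p y)"
proof (induction rule: hom_poly.induct)
  case (times k d p)
  then show ?case using hom_poly.times[of k n d "\<lambda>y. c * p y"] by (simp add: mult.left_commute)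
qed (auto simp: distrib_left intro: hom_poly.intros)

lemma hom_poly_diff: "hom_poly n d p \<Longrightarrow> hom_poly n d q \<Longrightarrow> hom_poly n d (\<lambda>y. p y - q y)"
  using hom_poly.add[of n d p "\<lambda>y. (-1) * q y"] hom_poly_scale[of n d q "-1"] by simp

lemma hom_poly_sum: "(\<And>i. i \<in> S \<Longrightarrow> hom_poly n d (p i)) \<Longrightarrow> hom_poly n d (\<lambda>y. \<Sum>i\<in>S. p i y)"
  by (induction S rule: infinite_finite_induct) (auto intro: hom_poly.intros)

lemma hom_poly_mult:
  assumes "hom_poly n d p" "hom_poly n e q" shows "hom_poly n (d + e) (\<lambda>y. p y * q y)"
  using assms(1)
proof (induction rule: hom_poly.induct)
  case (const c)
  then show ?case using hom_poly_scale[OF assms(2)] by simp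
next
  case (times k d p)
  then show ?case using hom_poly.times[of k n "d + e" "\<lambda>y. p y * q y"] by (simp add: mult.assoc)
qed (auto simp: distrib_right intro: hom_poly.intros)

lemma hom_poly_prod:
  "finite S \<Longrightarrow> (\<And>i. i \<in> S \<Longrightarrow> hom_poly n 1 (p i)) \<Longrightarrow> hom_poly n (card S) (\<lambda>y. \<Prod>i\<in>S. p i y)"
proof (induction S rule: finite_induct)
  case empty
  then show ?case using hom_poly.const[of n 1] by simp
next
  case (insert i S)
  then show ?case using hom_poly_mult[of n 1 "p i" "card S" "\<lambda>y. \<Prod>i\<in>S. p i y"] by (simp add: plus_1_eq_Suc)
qed

lemma hom_poly_var: "k \<in> {1..n} \<Longrightarrow> hom_poly n 1 (\<lambda>y. y k)"
  using hom_poly.times[of k n 0 "\<lambda>_. 1"] hom_poly.const[of n 1] by (simp add: One_nat_def)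

section \<open>Derivatives of forms and Euler's identity\<close>

definition pderv :: "nat \<Rightarrow> ((nat \<Rightarrow> complex) \<Rightarrow> complex) \<Rightarrow> (nat \<Rightarrow> complex) \<Rightarrow> complex" where
  "pderv k p y = deriv (\<lambda>t. p (y(k := t))) (y k)"

lemma hom_poly_differentiable:
  "hom_poly n d p \<Longrightarrow> (\<lambda>t. p (y(k := t))) field_differentiable at z"
proof (induction rule: hom_poly.induct)
  case (times j d p)
  moreover have "(\<lambda>t. (y(k := t)) j) field_differentiable at z"
    by (cases "j = k") (auto intro: field_differentiable_ident)
  ultimately show ?case by (intro field_differentiable_mult)
qed (auto intro: field_differentiable_add)

lemma pderv_const [simp]: "pderv k (\<lambda>_. c) y = 0"
  by (simp add: pderv_def)

lemma pderv_add:
  "hom_poly n d p \<Longrightarrow> hom_poly n e q \<Longrightarrow> pderv k (\<lambda>y. p y + q y) y = pderv k p y + pderv k q y"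
  unfolding pderv_def by (intro deriv_add hom_poly_differentiable)

lemma pderv_diff:
  "hom_poly n d p \<Longrightarrow> hom_poly n e q \<Longrightarrow> pderv k (\<lambda>y. p y - q y) y = pderv k p y - pderv k q y"
  unfolding pderv_def by (intro deriv_diff hom_poly_differentiable)

lemma pderv_times:
  assumes "hom_poly n d p"
  shows "pderv k (\<lambda>y. y j * p y) y = (if j = k then p y else 0) + y j * pderv k p y"
proof -
  have "(\<lambda>t. (y(k := t)) j) field_differentiable at (y k)"
    by (cases "j = k") (auto intro: field_differentiable_ident)
  then have "pderv k (\<lambda>y. y j * p y) y = y j * pderv k p y + deriv (\<lambda>t. (y(k := t)) j) (y k) * p y"
    unfolding pderv_def by (subst deriv_mult) (auto intro: hom_poly_differentiable[OF assms])
  then show ?thesis by (cases "j = k") auto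
qed

lemma pderv_sum:
  "(\<And>i. i \<in> S \<Longrightarrow> hom_poly n d (p i)) \<Longrightarrow> pderv k (\<lambda>y. \<Sum>i\<in>S. p i y) y = (\<Sum>i\<in>S. pderv k (p i) y)"
proof (induction S rule: infinite_finite_induct)
  case (insert i S)
  then show ?case
    using pderv_add[of n d "p i" d "\<lambda>y. \<Sum>i\<in>S. p i y" k y] hom_poly_sum[of S n d p] by simp
qed auto

text \<open>Degree 0 is carried along because there is no degree below it: in the product rule for
  y_j p with p constant, the term containing the derivative of p has to be recognised as 0.\<close>

lemma hom_poly_pderv_aux:
  "hom_poly n d p \<Longrightarrow> (d = 0 \<longrightarrow> pderv k p = (\<lambda>_. 0)) \<and> (\<forall>e. d = Suc e \<longrightarrow> hom_poly n e (pderv k p))"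
proof (induction rule: hom_poly.induct)
  case (add d p q)
  have "pderv k (\<lambda>y. p y + q y) = (\<lambda>y. pderv k p y + pderv k q y)"
    using pderv_add[OF add.hyps] by blast
  then show ?case using add.IH by (auto intro: hom_poly.intros)
next
  case (times j d p)
  have eq: "pderv k (\<lambda>y. y j * p y) = (\<lambda>y. (if j = k then p y else 0) + y j * pderv k p y)"
    using pderv_times[OF times.hyps(2)] by blast
  have "hom_poly n d (\<lambda>y. if j = k then p y else 0)"
    using times.hyps by (cases "j = k") (auto intro: hom_poly.intros)
  moreover have "hom_poly n d (\<lambda>y. y j * pderv k p y)"
    using times by (cases d) (auto intro: hom_poly.intros)
  ultimately show ?case unfolding eq by (auto intro: hom_poly.add)
qed (auto simp: fun_eq_iff pderv_def intro: hom_poly.intros)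

lemma hom_poly_pderv: "hom_poly n (Suc d) p \<Longrightarrow> hom_poly n d (pderv k p)"
  using hom_poly_pderv_aux by blast

lemma euler_identity:
  "hom_poly n d p \<Longrightarrow> (\<Sum>k=1..n. y k * pderv k p y) = of_nat d * p y"
proof (induction rule: hom_poly.induct)
  case (add d p q)
  then show ?case by (simp add: pderv_add[OF add.hyps] distrib_left sum.distrib)
next
  case (times j d p)
  have "(\<Sum>k=1..n. y k * pderv k (\<lambda>y. y j * p y) y)
      = (\<Sum>k=1..n. (if j = k then y k * p y else 0) + y j * (y k * pderv k p y))"
    by (intro sum.cong) (auto simp: pderv_times[OF times.hyps(2)] algebra_simps)
  also have "\<dots> = y j * p y + y j * (of_nat d * p y)"
    using times by (simp add: sum.distrib flip: sum_distrib_left)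
  finally show ?case by (simp add: algebra_simps)
qed auto

lemma hom_poly_linear_subst:
  assumes "hom_poly n d p" "\<And>k. k \<in> {1..n} \<Longrightarrow> hom_poly n 1 (\<lambda>y. g y k)"
  shows "hom_poly n d (\<lambda>y. p (g y))"
  using assms(1)
proof (induction rule: hom_poly.induct)
  case (times k d p)
  then show ?case using hom_poly_mult[of n 1 "\<lambda>y. g y k" d] assms(2) by (simp add: plus_1_eq_Suc)
qed (auto intro: hom_poly.intros)

section \<open>Symmetric syzygies\<close>

text \<open>The bilinear form h evaluated at the Koszul vectors y_j e_i - y_i e_j and y_l e_k - y_k
  e_l, both of which y annihilates. Equivalently the Kulkarni-Nomizu product of h with y y^T; for
  symmetric h it therefore has all symmetries of a curvature tensor.\<close>

definition Qf :: "(nat \<Rightarrow> complex) \<Rightarrow> (nat \<Rightarrow> nat \<Rightarrow> complex) \<Rightarrow> nat \<Rightarrow> nat \<Rightarrow> nat \<Rightarrow> nat \<Rightarrow> complex" where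
  "Qf y h i j k l = h i k * y j * y l - h j k * y i * y l - h i l * y j * y k + h j l * y i * y k"

text \<open>Differentiate the relation in y_k: the product rule releases p_k from the k-th
  summand.\<close>

lemma pderv_syzygy:
  assumes p: "\<And>j. j \<in> {1..n} \<Longrightarrow> hom_poly n d (p j)"
    and syz: "\<And>y. (\<Sum>j=1..n. y j * p j y) = 0" and k: "k \<in> {1..n}"
  shows "(\<Sum>j=1..n. y j * pderv k (p j) y) = - p k y"
proof -
  have "0 = pderv k (\<lambda>y. \<Sum>j=1..n. y j * p j y) y"
    by (simp add: syz)
  also have "\<dots> = (\<Sum>j=1..n. pderv k (\<lambda>y. y j * p j y) y)"
    by (rule pderv_sum[where d = "Suc d"]) (rule hom_poly.times[OF _ p])
  also have "\<dots> = (\<Sum>j=1..n. (if j = k then p j y else 0) + y j * pderv k (p j) y)"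
    by (intro sum.cong refl) (rule pderv_times[OF p])
  also have "\<dots> = p k y + (\<Sum>j=1..n. y j * pderv k (p j) y)"
    using k by (simp add: sum.distrib)
  finally show ?thesis by (simp add: eq_neg_iff_add_eq_0 add.commute)
qed

text \<open>The coefficients are those of the linearised curvature tensor of the symmetric tensor \<open>u\<close>:
  two applications of Euler's identity invert the map \<open>R \<mapsto> (\<Sum>k l. y k * y l * R i k j l)\<close>.\<close>

lemma symmetric_syzygy:
  assumes u: "\<And>i j. i \<in> {1..n} \<Longrightarrow> j \<in> {1..n} \<Longrightarrow> hom_poly n (Suc (Suc e)) (u i j)"
    and sym: "\<And>i j. u i j = u j i"
    and syz: "\<And>i y. i \<in> {1..n} \<Longrightarrow> (\<Sum>j=1..n. y j * u i j y) = 0"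
  obtains R where "\<And>i k j l. i \<in> {1..n} \<Longrightarrow> k \<in> {1..n} \<Longrightarrow> j \<in> {1..n} \<Longrightarrow> l \<in> {1..n} \<Longrightarrow> hom_poly n e (R i k j l)"
    "\<And>y h. (\<Sum>i=1..n. \<Sum>j=1..n. u i j y * h i j)
       = (\<Sum>i=1..n. \<Sum>k=1..n. \<Sum>j=1..n. \<Sum>l=1..n. R i k j l y * Qf y h i k j l)"
proof -
  let ?d = "of_nat (Suc (Suc e)) :: complex"
  \<comment> \<open>Antisymmetrise one derivative in i and k, then another in j and l. Contracting
    either stage with y gives back a multiple of the previous tensor.\<close>
  define w where "w i k j = (\<lambda>y. pderv k (u i j) y - pderv i (u k j) y)" for i k j
  define R where "R i k j l = (\<lambda>y. pderv l (w i k j) y - pderv j (w i k l) y)" for i k j l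
  have w: "hom_poly n (Suc e) (w i k j)" if "i \<in> {1..n}" "k \<in> {1..n}" "j \<in> {1..n}" for i k j
    unfolding w_def using that by (intro hom_poly_diff hom_poly_pderv u)
  have R: "hom_poly n e (R i k j l)" if "i \<in> {1..n}" "k \<in> {1..n}" "j \<in> {1..n}" "l \<in> {1..n}" for i k j l
    unfolding R_def using that by (intro hom_poly_diff hom_poly_pderv w)
  have du: "(\<Sum>j=1..n. y j * pderv k (u i j) y) = - u i k y" if "i \<in> {1..n}" "k \<in> {1..n}" for i k y
    using that by (intro pderv_syzygy[where d = "Suc (Suc e)"] u syz)
  \<comment> \<open>Euler's identity contributes d, the degree of u, and the differentiated syzygy
    of row j contributes 1.\<close>
  have w1: "(\<Sum>k=1..n. y k * w i k j y) = (?d + 1) * u i j y" if "i \<in> {1..n}" "j \<in> {1..n}" for i j y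
  proof -
    have "(\<Sum>k=1..n. y k * w i k j y) = (\<Sum>k=1..n. y k * pderv k (u i j) y) - (\<Sum>k=1..n. y k * pderv i (u j k) y)"
      by (simp add: w_def right_diff_distrib sum_subtractf sym[of j])
    then show ?thesis
      using that sym[of j i] by (simp add: euler_identity[OF u] du algebra_simps)
  qed
  \<comment> \<open>Differentiating the syzygies of rows i and k gives -u_ik + u_ki, which cancels
    by symmetry. Thus \<open>w\<close> is again a syzygy in its last index and the argument can be
    repeated.\<close>
  have w2: "(\<Sum>l=1..n. y l * w i k l y) = 0" if "i \<in> {1..n}" "k \<in> {1..n}" for i k y
    using that sym[of k i] by (simp add: w_def right_diff_distrib sum_subtractf du)
  \<comment> \<open>This time Euler's identity contributes d - 1, the degree of \<open>w\<close>,
    and the syzygy contributes 1.\<close>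
  have R1: "(\<Sum>l=1..n. y l * R i k j l y) = ?d * w i k j y"
    if "i \<in> {1..n}" "k \<in> {1..n}" "j \<in> {1..n}" for i k j y
  proof -
    have "(\<Sum>l=1..n. y l * pderv j (w i k l) y) = - w i k j y"
      using that by (intro pderv_syzygy[where d = "Suc e"] w w2)
    moreover have "(\<Sum>l=1..n. y l * pderv l (w i k j) y) = of_nat (Suc e) * w i k j y"
      using that by (intro euler_identity w)
    ultimately show ?thesis
      by (simp add: R_def right_diff_distrib sum_subtractf algebra_simps)
  qed
  have R2: "(\<Sum>k=1..n. \<Sum>l=1..n. R i k j l y * y k * y l) = ?d * (?d + 1) * u i j y"
    if "i \<in> {1..n}" "j \<in> {1..n}" for i j y
  proof -
    have "(\<Sum>k=1..n. \<Sum>l=1..n. R i k j l y * y k * y l) = (\<Sum>k=1..n. y k * (\<Sum>l=1..n. y l * R i k j l y))"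
      by (simp add: sum_distrib_left mult_ac)
    also have "\<dots> = (\<Sum>k=1..n. y k * (?d * w i k j y))"
      using that by (intro sum.cong refl) (simp only: R1)
    also have "\<dots> = ?d * (\<Sum>k=1..n. y k * w i k j y)"
      by (simp only: sum_distrib_left mult.left_commute)
    finally show ?thesis using that by (simp only: w1 mult.assoc)
  qed
  have anti1: "R k i j l y = - R i k j l y"
    if "i \<in> {1..n}" "k \<in> {1..n}" "j \<in> {1..n}" "l \<in> {1..n}" for i k j l y
  proof -
    have "pderv a (w k i b) y = - pderv a (w i k b) y" if b: "b \<in> {1..n}" for a b
    proof -
      have "w k i b = (\<lambda>y. 0 - w i k b y)" by (simp add: w_def)
      then show ?thesis
        using pderv_diff[OF hom_poly.zero w[OF \<open>i \<in> {1..n}\<close> \<open>k \<in> {1..n}\<close> b], of a y] by simp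
    qed
    with that show ?thesis by (simp add: R_def)
  qed
  have anti2: "R i k l j y = - R i k j l y" for i k j l y
    by (simp add: R_def)
  \<comment> \<open>The factor 4 counts the summands of \<open>Qf\<close>: the two antisymmetries of
    \<open>R\<close> and a renaming of indices make their four contributions equal.\<close>
  have key: "4 * ?d * (?d + 1) * (\<Sum>i=1..n. \<Sum>j=1..n. u i j y * h i j)
       = (\<Sum>i=1..n. \<Sum>k=1..n. \<Sum>j=1..n. \<Sum>l=1..n. R i k j l y * Qf y h i k j l)" for y h
  proof -
    let ?S = "\<lambda>f. \<Sum>i=1..n. \<Sum>k=1..n. \<Sum>j=1..n. \<Sum>l=1..n. (f i k j l :: complex)"
    let ?T = "\<lambda>i k j l. R i k j l y * h i j * y k * y l"
    have swap1: "?S (\<lambda>i k j l. f k i j l) = ?S f" for f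
      by (rule sum.swap)
    have swap2: "?S (\<lambda>i k j l. f i k l j) = ?S f" for f
      by (intro sum.cong refl sum.swap)
    have "?d * (?d + 1) * (\<Sum>i=1..n. \<Sum>j=1..n. u i j y * h i j)
        = (\<Sum>i=1..n. \<Sum>j=1..n. (?d * (?d + 1) * u i j y) * h i j)"
      by (simp only: sum_distrib_left mult.assoc)
    also have "\<dots> = (\<Sum>i=1..n. \<Sum>j=1..n. (\<Sum>k=1..n. \<Sum>l=1..n. R i k j l y * y k * y l) * h i j)"
      by (intro sum.cong refl) (simp only: R2)
    also have "\<dots> = (\<Sum>i=1..n. \<Sum>j=1..n. \<Sum>k=1..n. \<Sum>l=1..n. ?T i k j l)"
      unfolding sum_distrib_right by (simp only: mult_ac)
    also have "\<dots> = ?S ?T"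
      by (intro sum.cong refl sum.swap)
    finally have S: "?S ?T = ?d * (?d + 1) * (\<Sum>i=1..n. \<Sum>j=1..n. u i j y * h i j)" ..
    have "?S (\<lambda>i k j l. R i k j l y * Qf y h i k j l)
        = ?S (\<lambda>i k j l. ?T i k j l + ?T k i j l + ?T i k l j + ?T k i l j)"
    proof (intro sum.cong refl)
      fix i k j l assume "i \<in> {1..n}" "k \<in> {1..n}" "j \<in> {1..n}" "l \<in> {1..n}"
      then have "R k i j l y = - R i k j l y" "R i k l j y = - R i k j l y" "R k i l j y = R i k j l y"
        using anti1[of i k j l y] anti2[of i k l j y] anti2[of k i l j y] by simp_all
      then show "R i k j l y * Qf y h i k j l = ?T i k j l + ?T k i j l + ?T i k l j + ?T k i l j"
        by (simp add: Qf_def algebra_simps)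
    qed
    also have "\<dots> = ?S ?T + ?S (\<lambda>i k j l. ?T k i j l) + ?S (\<lambda>i k j l. ?T i k l j) + ?S (\<lambda>i k j l. ?T k i l j)"
      by (simp only: sum.distrib)
    also have "?S (\<lambda>i k j l. ?T k i l j) = ?S (\<lambda>i k j l. ?T i k l j)"
      by (rule swap1)
    also have "?S (\<lambda>i k j l. ?T i k l j) = ?S ?T"
      by (rule swap2)
    also have "?S (\<lambda>i k j l. ?T k i j l) = ?S ?T"
      by (rule swap1)
    finally show ?thesis unfolding S by simp
  qed
  define c where "c = 1 / (4 * ?d * (?d + 1))"
  have nz: "4 * ?d * (?d + 1) \<noteq> 0"
  proof -
    have "?d + 1 = of_nat (Suc (Suc (Suc e)))" by simp
    then have "?d + 1 \<noteq> 0" "?d \<noteq> 0" by (simp_all only: of_nat_eq_0_iff nat.distinct not_False_eq_True)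
    then show ?thesis by (simp only: mult_eq_0_iff) simp
  qed
  show ?thesis
  proof (rule that[of "\<lambda>i k j l y. c * R i k j l y"])
    show "hom_poly n e (\<lambda>y. c * R i k j l y)" if "i \<in> {1..n}" "k \<in> {1..n}" "j \<in> {1..n}" "l \<in> {1..n}" for i k j l
      using that by (intro hom_poly_scale R)
    show "(\<Sum>i=1..n. \<Sum>j=1..n. u i j y * h i j)
       = (\<Sum>i=1..n. \<Sum>k=1..n. \<Sum>j=1..n. \<Sum>l=1..n. c * R i k j l y * Qf y h i k j l)" for y h
    proof -
      have "(\<Sum>i=1..n. \<Sum>j=1..n. u i j y * h i j) = c * (4 * ?d * (?d + 1) * (\<Sum>i=1..n. \<Sum>j=1..n. u i j y * h i j))"
        using nz by (simp add: c_def)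
      then show ?thesis unfolding key by (simp only: sum_distrib_left mult.assoc)
    qed
  qed
qed

section \<open>Minors with prescribed columns\<close>

text \<open>For a pair (a, b) without 0, row r >= 1 is row 0 with h replaced by the symmetric
  product of e_r and y, whose (a, b) entry is [a = r] y_b + [b = r] y_a. A loop (i, i) thus carries
  h_ii and 2 y_i, twice the corresponding column of the second Jacobian matrix.\<close>

definition col_entry :: "(nat \<Rightarrow> complex) \<Rightarrow> (nat \<Rightarrow> nat \<Rightarrow> complex) \<Rightarrow> nat \<Rightarrow> nat \<times> nat \<Rightarrow> complex" where
  "col_entry y h r c =
     (if r = 0 then if fst c = 0 then y (snd c) else h (fst c) (snd c)
      else if fst c = 0 then 0
      else (if r = fst c then y (snd c) else 0) + (if r = snd c then y (fst c) else 0))"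

abbreviation sqdet :: "nat \<Rightarrow> (nat \<Rightarrow> nat \<Rightarrow> complex) \<Rightarrow> complex" where
  "sqdet n A \<equiv> Determinant.det (Matrix.mat (Suc n) (Suc n) (\<lambda>(r, t). A r t))"

definition minor :: "nat \<Rightarrow> (nat \<Rightarrow> nat \<times> nat) \<Rightarrow> (nat \<Rightarrow> complex) \<Rightarrow> (nat \<Rightarrow> nat \<Rightarrow> complex) \<Rightarrow> complex" where
  "minor n e y h = sqdet n (\<lambda>r t. col_entry y h r (e t))"

lemma sqdet_leibniz:
  "sqdet n A = (\<Sum>\<pi> | \<pi> permutes {0..n}. of_int (sign \<pi>) * (\<Prod>r=0..n. A r (\<pi> r)))"
proof -
  have "A r (\<pi> r) = Matrix.mat (Suc n) (Suc n) (\<lambda>(r, t). A r t) $$ (r, \<pi> r)"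
    if "\<pi> permutes {0..n}" "r \<in> {0..n}" for \<pi> r
    using permutes_in_image[OF that(1), of r] that(2) by simp
  then show ?thesis
    by (subst det_def'[of _ "Suc n"]) (auto simp: atLeastLessThanSuc_atLeastAtMost intro!: sum.cong prod.cong)
qed

text \<open>Cofactors are kept as signed sums over permutations, where their independence of row 0
  and their degree in the lower entries can be read off.\<close>

lemma sqdet_expand_row0:
  "sqdet n A = (\<Sum>t=0..n. A 0 t * (\<Sum>\<pi> | \<pi> permutes {0..n} \<and> \<pi> 0 = t. of_int (sign \<pi>) * (\<Prod>r=1..n. A r (\<pi> r))))"
proof -
  let ?P = "{\<pi>. \<pi> permutes {0..n}}"
  have fin: "finite ?P" by (simp add: finite_permutations)
  have "sqdet n A = (\<Sum>\<pi>\<in>?P. A 0 (\<pi> 0) * (of_int (sign \<pi>) * (\<Prod>r=1..n. A r (\<pi> r))))"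
    unfolding sqdet_leibniz
    by (intro sum.cong refl) (simp add: prod.atLeast_Suc_atMost One_nat_def)
  also have "\<dots> = (\<Sum>t=0..n. \<Sum>\<pi> | \<pi> \<in> ?P \<and> \<pi> 0 = t. A 0 (\<pi> 0) * (of_int (sign \<pi>) * (\<Prod>r=1..n. A r (\<pi> r))))"
    by (rule sum.group[symmetric]) (use fin permutes_in_image in \<open>fastforce+\<close>)
  also have "\<dots> = (\<Sum>t=0..n. A 0 t * (\<Sum>\<pi> | \<pi> permutes {0..n} \<and> \<pi> 0 = t. of_int (sign \<pi>) * (\<Prod>r=1..n. A r (\<pi> r))))"
    by (auto simp: sum_distrib_left intro!: sum.cong)
  finally show ?thesis .
qed

lemma sqdet_equal_rows:
  assumes "i \<in> {1..n}" "\<And>t. t \<le> n \<Longrightarrow> A 0 t = A i t"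
  shows "sqdet n A = 0"
  by (rule det_identical_rows[of _ "Suc n" 0 i]) (use assms in \<open>auto intro!: eq_vecI\<close>)

lemma minor_decomposition:
  assumes n: "n \<ge> 2" and e: "\<And>t. t \<le> n \<Longrightarrow> e t \<in> {0..n} \<times> {1..n}"
  obtains p R where "hom_poly n (n + 1) p"
    "\<And>i k j l. i \<in> {1..n} \<Longrightarrow> k \<in> {1..n} \<Longrightarrow> j \<in> {1..n} \<Longrightarrow> l \<in> {1..n} \<Longrightarrow> hom_poly n (n - 2) (R i k j l)"
    "\<And>y h. (\<And>i j. h i j = h j i) \<Longrightarrow> minor n e y h
       = p y + (\<Sum>i=1..n. \<Sum>k=1..n. \<Sum>j=1..n. \<Sum>l=1..n. R i k j l y * Qf y h i k j l)"
proof -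
  \<comment> \<open>No entry below row 0 involves h, so h may be set to 0 here and the cofactors
    depend on y alone.\<close>
  define cof where "cof t y = (\<Sum>\<pi> | \<pi> permutes {0..n} \<and> \<pi> 0 = t. of_int (sign \<pi>) *
      (\<Prod>r=1..n. col_entry y (\<lambda>_ _. 0) r (e (\<pi> r))))" for t y
  have expand: "sqdet n (\<lambda>r t. if r = 0 then \<eta> t else col_entry y h r (e t)) = (\<Sum>t=0..n. \<eta> t * cof t y)" for \<eta> y h
    unfolding sqdet_expand_row0 cof_def by (auto simp: col_entry_def intro!: sum.cong arg_cong2[where f = "(*)"] prod.cong)
  have cof: "hom_poly n n (cof t)" for t
  proof -
    have "hom_poly n 1 (\<lambda>y. col_entry y (\<lambda>_ _. 0) r (e (\<pi> r)))" if "\<pi> permutes {0..n}" "r \<in> {1..n}" for \<pi> r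
    proof -
      have "\<pi> r \<le> n" using permutes_in_image[OF that(1), of r] that(2) by auto
      then obtain a b where ab: "e (\<pi> r) = (a, b)" "a \<le> n" "b \<in> {1..n}"
        using e[of "\<pi> r"] by (cases "e (\<pi> r)") auto
      have "hom_poly n 1 (\<lambda>y. if r = a then y b else 0)"
        using ab by (cases "r = a") (auto intro: hom_poly_var hom_poly.zero)
      moreover have "hom_poly n 1 (\<lambda>y. if r = b then y a else 0)" if "a \<noteq> 0"
        using ab that by (cases "r = b") (auto intro: hom_poly_var hom_poly.zero)
      ultimately show ?thesis
        using \<open>r \<in> {1..n}\<close> by (cases "a = 0") (auto simp: col_entry_def ab cong: if_cong intro: hom_poly.intros)
    qed
    then have "hom_poly n (card {1..n}) (\<lambda>y. \<Prod>r=1..n. col_entry y (\<lambda>_ _. 0) r (e (\<pi> r)))" if "\<pi> permutes {0..n}" for \<pi>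
      using that by (intro hom_poly_prod) auto
    then show ?thesis
      unfolding cof_def by (auto intro!: hom_poly_sum hom_poly_scale)
  qed
  define p where "p y = (\<Sum>t=0..n. (if fst (e t) = 0 then y (snd (e t)) * cof t y else 0))" for y
  have p: "hom_poly n (n + 1) p"
    unfolding p_def
  proof (rule hom_poly_sum)
    fix t assume "t \<in> {0..n}"
    then have "snd (e t) \<in> {1..n}" using e[of t] by auto
    from hom_poly.times[OF this cof, of t]
    show "hom_poly n (n + 1) (\<lambda>y. if fst (e t) = 0 then y (snd (e t)) * cof t y else 0)"
      by (cases "fst (e t) = 0") (simp_all add: hom_poly.zero Suc_eq_plus1)
  qed
  \<comment> \<open>Each order of the pair receives half of the cofactor. This makes u symmetric,
    and a loop still receives the whole cofactor.\<close>
  define u where "u i j y = (\<Sum>t=0..n. ((if e t = (i, j) then 1/2 else 0) + (if e t = (j, i) then 1/2 else 0)) * cof t y)" for i j y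
  have u: "hom_poly n n (u i j)" for i j
    unfolding u_def by (intro hom_poly_sum hom_poly_scale cof)
  have usym: "u i j = u j i" for i j
    by (simp add: u_def fun_eq_iff add.commute)
  have usum: "(\<Sum>i=1..n. \<Sum>j=1..n. u i j y * h i j) = (\<Sum>t=0..n. if fst (e t) = 0 then 0 else h (fst (e t)) (snd (e t)) * cof t y)"
    if hsym: "\<And>i j. h i j = h j i" for y h
  proof -
    have "(\<Sum>i=1..n. \<Sum>j=1..n. u i j y * h i j) = (\<Sum>i=1..n. \<Sum>j=1..n. \<Sum>t=0..n.
        ((if e t = (i, j) then 1/2 else 0) + (if e t = (j, i) then 1/2 else 0)) * cof t y * h i j)"
      by (simp only: u_def sum_distrib_right)
    also have "\<dots> = (\<Sum>t=0..n. \<Sum>i=1..n. \<Sum>j=1..n.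
        ((if e t = (i, j) then 1/2 else 0) + (if e t = (j, i) then 1/2 else 0)) * cof t y * h i j)"
      by (subst sum.swap[of _ "{0..n}"], subst sum.swap[of _ "{0..n}"]) (rule refl)
    also have "\<dots> = (\<Sum>t=0..n. if fst (e t) = 0 then 0 else h (fst (e t)) (snd (e t)) * cof t y)"
    proof (intro sum.cong refl)
      fix t assume "t \<in> {0..n}"
      then obtain a b where ab: "e t = (a, b)" "a \<le> n" "b \<in> {1..n}"
        using e[of t] by (cases "e t") auto
      have 1: "(\<Sum>i=1..n. \<Sum>j=1..n. if a = i \<and> b = j then h i j else 0) = (if a = 0 then 0 else h a b)"
      proof -
        have "(\<Sum>i=1..n. \<Sum>j=1..n. if a = i \<and> b = j then h i j else 0) = (\<Sum>i=1..n. if a = i then h i b else 0)"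
          using ab by (intro sum.cong refl) auto
        then show ?thesis using ab by auto
      qed
      have 2: "(\<Sum>i=1..n. \<Sum>j=1..n. if a = j \<and> b = i then h i j else 0) = (if a = 0 then 0 else h a b)"
      proof -
        have "(\<Sum>i=1..n. \<Sum>j=1..n. if a = j \<and> b = i then h i j else 0)
            = (\<Sum>j=1..n. \<Sum>i=1..n. if a = j \<and> b = i then h i j else 0)"
          by (rule sum.swap)
        also have "\<dots> = (\<Sum>j=1..n. \<Sum>i=1..n. if a = j \<and> b = i then h j i else 0)"
          by (intro sum.cong refl if_cong) (rule hsym)
        finally show ?thesis unfolding 1 .
      qed
      have "(\<Sum>i=1..n. \<Sum>j=1..n. ((if e t = (i, j) then 1/2 else 0) + (if e t = (j, i) then 1/2 else 0)) * cof t y * h i j)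
        = (\<Sum>i=1..n. \<Sum>j=1..n. cof t y / 2 * ((if a = i \<and> b = j then h i j else 0) + (if a = j \<and> b = i then h i j else 0)))"
      proof -
        have "((if e t = (i, j) then 1/2 else 0) + (if e t = (j, i) then 1/2 else 0)) * cof t y * h i j
            = cof t y / 2 * ((if a = i \<and> b = j then h i j else 0) + (if a = j \<and> b = i then h i j else 0))" for i j
        proof -
          have "e t = (i, j) \<longleftrightarrow> a = i \<and> b = j" "e t = (j, i) \<longleftrightarrow> a = j \<and> b = i"
            by (simp_all add: ab)
          moreover have "((if P then 1/2 else 0) + (if P' then 1/2 else 0)) * x * z
              = x / 2 * ((if P then z else 0) + (if P' then z else 0))" for P P' and x z :: complex
            by (cases P; cases P') simp_all
          ultimately show ?thesis by simp
        qed
        then show ?thesis by (simp only:)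
      qed
      also have "\<dots> = cof t y / 2 * ((if a = 0 then 0 else h a b) + (if a = 0 then 0 else h a b))"
        by (simp only: sum_distrib_left[symmetric] sum.distrib 1 2)
      finally show "(\<Sum>i=1..n. \<Sum>j=1..n. ((if e t = (i, j) then 1/2 else 0) + (if e t = (j, i) then 1/2 else 0)) * cof t y * h i j)
         = (if fst (e t) = 0 then 0 else h (fst (e t)) (snd (e t)) * cof t y)"
        by (simp add: ab)
    qed
    finally show ?thesis .
  qed
  have syz: "(\<Sum>j=1..n. y j * u i j y) = 0" if i: "i \<in> {1..n}" for i y
  proof -
    \<comment> \<open>Row i written as a Hessian. Columns (0, j) have entry 0 in row i and drop out
      of \<open>usum\<close>, so the sum below is the determinant with row i also in place of row 0.
      Its two halves both equal the wanted contraction.\<close>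
    define h where "h a b = (if a = i then y b else 0) + (if b = i then y a else 0)" for a b
    have "(\<Sum>a=1..n. \<Sum>b=1..n. u a b y * h a b) = (\<Sum>t=0..n. col_entry y h i (e t) * cof t y)"
      by (subst usum) (use i in \<open>auto simp: h_def col_entry_def add.commute intro!: sum.cong\<close>)
    also have "\<dots> = 0"
      unfolding expand[symmetric, of _ y h] using i by (intro sqdet_equal_rows[OF i]) auto
    finally have "(\<Sum>a=1..n. \<Sum>b=1..n. u a b y * h a b) = 0" .
    also have "(\<Sum>a=1..n. \<Sum>b=1..n. u a b y * h a b) =
        (\<Sum>a=1..n. \<Sum>b=1..n. if a = i then u a b y * y b else 0) + (\<Sum>a=1..n. \<Sum>b=1..n. if b = i then u a b y * y a else 0)"
      unfolding sum.distrib[symmetric] by (intro sum.cong refl) (simp add: h_def algebra_simps)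
    also have "(\<Sum>a=1..n. \<Sum>b=1..n. if a = i then u a b y * y b else 0) = (\<Sum>b=1..n. u i b y * y b)"
      using i by (subst sum.swap) simp
    also have "(\<Sum>a=1..n. \<Sum>b=1..n. if b = i then u a b y * y a else 0) = (\<Sum>b=1..n. u i b y * y b)"
      using i by (simp add: usym[of i])
    finally show ?thesis by (simp add: mult.commute)
  qed
  \<comment> \<open>The degree n of u allows two derivatives; what is left is the exponent n - 2 of
    the theorem.\<close>
  obtain m where m: "n = Suc (Suc m)" using n by (metis One_nat_def Suc_1 add_2_eq_Suc le_Suc_ex)
  have u2: "hom_poly n (Suc (Suc m)) (u i j)" for i j
    using u[of i j] by (simp only: m[symmetric])
  show ?thesis
  proof (rule symmetric_syzygy[OF u2 usym syz])
    fix R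
    assume R: "\<And>i k j l. i \<in> {1..n} \<Longrightarrow> k \<in> {1..n} \<Longrightarrow> j \<in> {1..n} \<Longrightarrow> l \<in> {1..n} \<Longrightarrow> hom_poly n m (R i k j l)"
      "\<And>y h. (\<Sum>i=1..n. \<Sum>j=1..n. u i j y * h i j)
         = (\<Sum>i=1..n. \<Sum>k=1..n. \<Sum>j=1..n. \<Sum>l=1..n. R i k j l y * Qf y h i k j l)"
    show thesis
    proof (rule that[OF p, of R])
      show "hom_poly n (n - 2) (R i k j l)" if "i \<in> {1..n}" "k \<in> {1..n}" "j \<in> {1..n}" "l \<in> {1..n}" for i k j l
        using R(1)[OF that] m by simp
      show "minor n e y h = p y + (\<Sum>i=1..n. \<Sum>k=1..n. \<Sum>j=1..n. \<Sum>l=1..n. R i k j l y * Qf y h i k j l)"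
        if hsym: "\<And>i j. h i j = h j i" for y h
      proof -
        have "minor n e y h = sqdet n (\<lambda>r t. if r = 0 then col_entry y h 0 (e t) else col_entry y h r (e t))"
          unfolding minor_def by (intro arg_cong[where f = Determinant.det]) (auto intro!: eq_matI)
        also have "\<dots> = (\<Sum>t=0..n. col_entry y h 0 (e t) * cof t y)"
          by (rule expand)
        also have "\<dots> = p y + (\<Sum>i=1..n. \<Sum>j=1..n. u i j y * h i j)"
          unfolding usum[OF hsym] p_def sum.distrib[symmetric] by (intro sum.cong refl) (simp add: col_entry_def)
        finally show ?thesis unfolding R(2) .
      qed
    qed
  qed
qed

section \<open>Minors of forests\<close>

text \<open>Every permutation that contributes moves only S, so the diagonal entries outside S
  factor out. The remaining block is left as a sum over permutations because S need not be an
  initial segment of the row numbers.\<close>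

lemma sqdet_support:
  assumes S: "S \<subseteq> {0..n}"
    and fixed: "\<And>\<pi> r. \<pi> permutes {0..n} \<Longrightarrow> (\<And>r. r \<le> n \<Longrightarrow> A r (\<pi> r) \<noteq> 0) \<Longrightarrow> r \<in> {0..n} - S \<Longrightarrow> \<pi> r = r"
  shows "sqdet n A = (\<Sum>\<pi> | \<pi> permutes S. of_int (sign \<pi>) * (\<Prod>r\<in>S. A r (\<pi> r))) * (\<Prod>r\<in>{0..n} - S. A r r)"
proof -
  have sub: "{\<pi>. \<pi> permutes S} \<subseteq> {\<pi>. \<pi> permutes {0..n}}"
    using permutes_subset[OF _ S] by blast
  have zero: "(\<Prod>r=0..n. A r (\<pi> r)) = 0" if "\<pi> permutes {0..n}" "\<not> \<pi> permutes S" for \<pi>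
  proof (rule ccontr)
    assume "(\<Prod>r=0..n. A r (\<pi> r)) \<noteq> 0"
    then have "A r (\<pi> r) \<noteq> 0" if "r \<le> n" for r using that by simp
    then have "\<pi> permutes S"
      using permutes_superset[OF that(1), of S] fixed[OF that(1)] by blast
    with that(2) show False ..
  qed
  have "sqdet n A = (\<Sum>\<pi> | \<pi> permutes S. of_int (sign \<pi>) * (\<Prod>r=0..n. A r (\<pi> r)))"
    unfolding sqdet_leibniz
    by (rule sum.mono_neutral_right) (use sub zero in \<open>auto simp: finite_permutations\<close>)
  also have "\<dots> = (\<Sum>\<pi> | \<pi> permutes S. of_int (sign \<pi>) * (\<Prod>r\<in>S. A r (\<pi> r)) * (\<Prod>r\<in>{0..n} - S. A r r))"
  proof (intro sum.cong refl)
    fix \<pi> assume "\<pi> \<in> {\<pi>. \<pi> permutes S}"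
    then have \<pi>: "\<pi> permutes S" by simp
    have "(\<Prod>r=0..n. A r (\<pi> r)) = (\<Prod>r\<in>S. A r (\<pi> r)) * (\<Prod>r\<in>{0..n} - S. A r (\<pi> r))"
      using S by (metis finite_atLeastAtMost mult.commute prod.subset_diff)
    also have "(\<Prod>r\<in>{0..n} - S. A r (\<pi> r)) = (\<Prod>r\<in>{0..n} - S. A r r)"
      using permutes_not_in[OF \<pi>] by (intro prod.cong) auto
    finally show "of_int (sign \<pi>) * (\<Prod>r=0..n. A r (\<pi> r)) = of_int (sign \<pi>) * (\<Prod>r\<in>S. A r (\<pi> r)) * (\<Prod>r\<in>{0..n} - S. A r r)"
      by simp
  qed
  finally show ?thesis by (simp add: sum_distrib_right)
qed

text \<open>The columns \<open>(v, p v)\<close> form a forest of depth at most one whose roots carry loops; the column of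
  a leaf is the only one meeting its row, so a nonzero term of the Leibniz formula moves only \<open>W \<union> {0}\<close>.\<close>

lemma minor_forest:
  assumes p: "\<And>v. v \<in> {1..n} \<Longrightarrow> p v \<in> {1..n} \<and> p (p v) = p v" "\<And>v. v \<in> W \<Longrightarrow> p v = v"
    and W: "W \<subseteq> {1..n}"
    and X: "fst X = 0 \<or> fst X \<in> W \<and> snd X \<in> W"
    and e: "e = (\<lambda>t. if t = 0 then X else (t, p t))"
  obtains c where "c \<noteq> 0"
    "\<And>y h. minor n e y h = c * (\<Prod>v\<in>{1..n} - W. y (p v)) *
       (\<Sum>\<pi> | \<pi> permutes insert 0 W. of_int (sign \<pi>) * (\<Prod>r\<in>insert 0 W. col_entry y h r (e (\<pi> r))))"
proof -
  \<comment> \<open>A root v outside \<open>W\<close> has the loop (v, v) as its column, with entry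
    2 y_v in row v; a leaf contributes y (p v) with coefficient 1.\<close>
  define c :: complex where "c = (\<Prod>v\<in>{1..n} - W. if p v = v then 2 else 1)"
  have "c \<noteq> 0" by (simp add: c_def)
  moreover have "minor n e y h = c * (\<Prod>v\<in>{1..n} - W. y (p v)) *
       (\<Sum>\<pi> | \<pi> permutes insert 0 W. of_int (sign \<pi>) * (\<Prod>r\<in>insert 0 W. col_entry y h r (e (\<pi> r))))" for y h
  proof -
    have "minor n e y h = (\<Sum>\<pi> | \<pi> permutes insert 0 W. of_int (sign \<pi>) * (\<Prod>r\<in>insert 0 W. col_entry y h r (e (\<pi> r))))
        * (\<Prod>r\<in>{0..n} - insert 0 W. col_entry y h r (e r))"
      unfolding minor_def
    proof (rule sqdet_support)
      show "insert 0 W \<subseteq> {0..n}" using W by auto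
      fix \<pi> r assume \<pi>: "\<pi> permutes {0..n}" and nz: "\<And>r. r \<le> n \<Longrightarrow> col_entry y h r (e (\<pi> r)) \<noteq> 0"
        and r: "r \<in> {0..n} - insert 0 W"
      \<comment> \<open>No index is sent to v by p, since idempotence would make v a root, and X
        vanishes in row v because v is outside \<open>W\<close>. Only column v is left for row
        v.\<close>
      have leaf: "\<pi> v = v" if v: "v \<in> {1..n}" "p v \<noteq> v" for v
      proof -
        have "v \<notin> W" using p(2) v by blast
        have "\<pi> v \<in> {0..n}" using permutes_in_image[OF \<pi>, of v] v by simp
        have "\<pi> v \<noteq> 0"
          using nz[of v] v X \<open>v \<notin> W\<close> by (auto simp: e col_entry_def split: if_splits)
        moreover have "v = \<pi> v \<or> v = p (\<pi> v)"
          using nz[of v] v \<open>\<pi> v \<noteq> 0\<close> by (auto simp: e col_entry_def split: if_splits)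
        moreover have "v \<noteq> p (\<pi> v)"
          using p(1)[of "\<pi> v"] v(2) \<open>\<pi> v \<in> {0..n}\<close> \<open>\<pi> v \<noteq> 0\<close> by auto
        ultimately show ?thesis by simp
      qed
      have r': "r \<in> {1..n}" "r \<notin> W" using r by auto
      show "\<pi> r = r"
      proof (cases "p r = r")
        case True
        have "\<pi> r \<in> {0..n}" using permutes_in_image[OF \<pi>, of r] r by simp
        have "\<pi> r \<noteq> 0"
          using nz[of r] r' X by (auto simp: e col_entry_def split: if_splits)
        have "r = \<pi> r \<or> r = p (\<pi> r)"
          using nz[of r] r' \<open>\<pi> r \<noteq> 0\<close> by (auto simp: e col_entry_def split: if_splits)
        \<comment> \<open>Otherwise column \<open>\<pi> r\<close> belongs to a leaf attached to r,
          and the row of that leaf already takes it.\<close>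
        moreover have "\<pi> r = r" if "r = p (\<pi> r)"
        proof (rule ccontr)
          assume "\<pi> r \<noteq> r"
          then have "\<pi> (\<pi> r) = \<pi> r"
            using leaf[of "\<pi> r"] that \<open>\<pi> r \<in> {0..n}\<close> \<open>\<pi> r \<noteq> 0\<close> by simp
          then show False using \<open>\<pi> r \<noteq> r\<close> permutes_inj[OF \<pi>] by (metis injD)
        qed
        ultimately show ?thesis by metis
      qed (use leaf r' in blast)
    qed
    also have "(\<Prod>r\<in>{0..n} - insert 0 W. col_entry y h r (e r)) = (\<Prod>v\<in>{1..n} - W. (if p v = v then 2 else 1) * y (p v))"
      by (intro prod.cong) (auto simp: e col_entry_def)
    finally show ?thesis by (simp add: c_def prod.distrib)
  qed
  ultimately show ?thesis using that by blast
qed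

lemma ex_image_mset_eq:
  "finite A \<Longrightarrow> size M = card A \<Longrightarrow> \<exists>p. image_mset p (mset_set A) = M"
proof (induction A arbitrary: M rule: finite_induct)
  case (insert a A)
  then obtain x N where M: "M = add_mset x N"
    by (metis card_insert_disjoint size_eq_Suc_imp_eq_union)
  with insert obtain p where p: "image_mset p (mset_set A) = N" by auto
  have "image_mset (p(a := x)) (mset_set A) = image_mset p (mset_set A)"
    using insert by (intro image_mset_cong) auto
  then have "image_mset (p(a := x)) (mset_set (insert a A)) = M"
    using insert p M by simp
  then show ?case by blast
qed auto

text \<open>Indices outside \<open>W\<close> that occur in \<alpha> become roots, each using up one
  of its occurrences; the other indices outside \<open>W\<close> are matched arbitrarily with the
  remaining occurrences. For v outside \<open>W\<close>, p v occurs in \<alpha>, so it is such a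
  root or lies in \<open>W\<close>; this gives idempotence.\<close>

lemma ex_forest:
  assumes W: "W \<subseteq> {1..n}" and \<alpha>: "set_mset \<alpha> \<subseteq> {1..n}" "size \<alpha> = n - card W"
  obtains p where "\<And>v. v \<in> {1..n} \<Longrightarrow> p v \<in> {1..n} \<and> p (p v) = p v" "\<And>v. v \<in> W \<Longrightarrow> p v = v"
    "image_mset p (mset_set ({1..n} - W)) = \<alpha>"
proof -
  define A where "A = {1..n} - W"
  define A1 where "A1 = A \<inter> set_mset \<alpha>"
  have fin: "finite A" "finite A1" by (auto simp: A_def A1_def)
  have sub: "mset_set A1 \<subseteq># \<alpha>"
    using subset_mset.order_trans[OF _ mset_set_set_mset_msubset, of "mset_set A1" \<alpha>]
    by (simp add: A1_def subset_imp_msubset_mset_set)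
  have "size \<alpha> = card A" using W \<alpha> by (simp add: A_def card_Diff_subset finite_subset[OF W])
  then have "size (\<alpha> - mset_set A1) = card (A - A1)"
    using sub fin by (simp add: size_Diff_submset card_Diff_subset A1_def)
  then obtain q where q: "image_mset q (mset_set (A - A1)) = \<alpha> - mset_set A1"
    using ex_image_mset_eq[of "A - A1"] fin by blast
  define p where "p v = (if v \<in> A - A1 then q v else v)" for v
  have img: "image_mset p (mset_set A) = \<alpha>"
  proof -
    have "mset_set A = mset_set (A - A1) + mset_set A1"
      using fin by (subst mset_set_Union[symmetric]) (auto simp: A1_def intro!: arg_cong[where f = mset_set])
    moreover have "image_mset p (mset_set (A - A1)) = image_mset q (mset_set (A - A1))"
      using fin by (intro image_mset_cong) (auto simp: p_def)
    moreover have "image_mset p (mset_set A1) = image_mset (\<lambda>v. v) (mset_set A1)"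
      using fin by (intro image_mset_cong) (auto simp: p_def)
    ultimately show ?thesis using q sub by simp
  qed
  have in\<alpha>: "p v \<in># \<alpha>" if "v \<in> A" for v
    unfolding img[symmetric] using that fin by simp
  show ?thesis
  proof (rule that[of p])
    show "p v \<in> {1..n} \<and> p (p v) = p v" if "v \<in> {1..n}" for v
    proof (cases "v \<in> A")
      case True
      then have "p v \<in># \<alpha>" by (rule in\<alpha>)
      then have "p v \<notin> A - A1" by (auto simp: A1_def)
      then show ?thesis using \<alpha> \<open>p v \<in># \<alpha>\<close> by (auto simp: p_def)
    qed (use that in \<open>auto simp: p_def\<close>)
    show "p v = v" if "v \<in> W" for v using that by (auto simp: p_def A_def)
    show "image_mset p (mset_set ({1..n} - W)) = \<alpha>" using img by (simp add: A_def)
  qed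
qed

section \<open>The span of the minors\<close>

text \<open>Membership only constrains the values at symmetric \<open>h\<close>.\<close>

inductive minor_span :: "nat \<Rightarrow> ((nat \<Rightarrow> complex) \<Rightarrow> (nat \<Rightarrow> nat \<Rightarrow> complex) \<Rightarrow> complex) \<Rightarrow> bool"
  for n :: nat where
  minor: "(\<And>t. t \<le> n \<Longrightarrow> e t \<in> {0..n} \<times> {1..n}) \<Longrightarrow> minor_span n (minor n e)"
| zero: "minor_span n (\<lambda>_ _. 0)"
| add: "minor_span n P \<Longrightarrow> minor_span n P' \<Longrightarrow> minor_span n (\<lambda>y h. P y h + P' y h)"
| scale: "minor_span n P \<Longrightarrow> minor_span n (\<lambda>y h. c * P y h)"
| cong: "minor_span n P \<Longrightarrow> (\<And>y h. (\<And>i j. h i j = h j i) \<Longrightarrow> P y h = P' y h) \<Longrightarrow> minor_span n P'"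

lemma minor_span_sum:
  "(\<And>i. i \<in> S \<Longrightarrow> minor_span n (P i)) \<Longrightarrow> minor_span n (\<lambda>y h. \<Sum>i\<in>S. P i y h)"
  by (induction S rule: infinite_finite_induct) (auto intro: minor_span.intros)

abbreviation monom_fun :: "nat multiset \<Rightarrow> (nat \<Rightarrow> complex) \<Rightarrow> complex" where
  "monom_fun \<alpha> y \<equiv> prod_mset (image_mset y \<alpha>)"

lemma prod_eq_monom_fun:
  "image_mset p (mset_set A) = \<alpha> \<Longrightarrow> (\<Prod>v\<in>A. y (p v)) = monom_fun \<alpha> y"
  by (auto simp: prod_unfold_prod_mset image_mset.compositionality o_def)

text \<open>With \<open>W\<close> empty only row 0 remains in the permutation sum, and there the
  extra column (0, j) contributes y_j.\<close>

lemma minor_span_monomial: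
  assumes "set_mset \<alpha> \<subseteq> {1..n}" "size \<alpha> = n" "j \<in> {1..n}"
  shows "minor_span n (\<lambda>y h. y j * monom_fun \<alpha> y)"
proof -
  obtain p where p: "\<And>v. v \<in> {1..n} \<Longrightarrow> p v \<in> {1..n} \<and> p (p v) = p v" "\<And>v. v \<in> {} \<Longrightarrow> p v = v"
    "image_mset p (mset_set ({1..n} - {})) = \<alpha>"
    by (rule ex_forest[of "{}" n \<alpha>]) (use assms in auto)
  define e where "e = (\<lambda>t. if t = 0 then (0, j) else (t, p t))"
  obtain c where c: "c \<noteq> 0"
    "\<And>y h. minor n e y h = c * (\<Prod>v\<in>{1..n} - {}. y (p v)) *
       (\<Sum>\<pi> | \<pi> permutes insert 0 {}. of_int (sign \<pi>) * (\<Prod>r\<in>insert 0 {}. col_entry y h r (e (\<pi> r))))"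
    by (rule minor_forest[of n p "{}" "(0, j)" e]) (use p(1) e_def in auto)
  have "minor n e y h = c * (y j * monom_fun \<alpha> y)" for y h
    unfolding c(2) prod_eq_monom_fun[OF p(3)] by (simp add: permutes_sing e_def col_entry_def)
  then have "(1 / c) * minor n e y h = y j * monom_fun \<alpha> y" for y h
    using c(1) by simp
  moreover have "minor_span n (minor n e)"
    by (rule minor_span.minor) (use assms p(1) in \<open>auto simp: e_def\<close>)
  ultimately show ?thesis
    using minor_span.scale[of n "minor n e" "1 / c"] by simp
qed

lemma leibniz_sum_3:
  assumes "(0::nat) \<noteq> i" "0 \<noteq> j" "i \<noteq> j"
  shows "(\<Sum>\<pi> | \<pi> permutes {0, i, j}. of_int (sign \<pi>) * (\<Prod>r\<in>{0, i, j}. A r (\<pi> r))) =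
    A 0 0 * A i i * A j j - A 0 0 * A i j * A j i - A 0 i * A i 0 * A j j
    + A 0 i * A i j * A j 0 + A 0 j * A i 0 * A j i - A 0 j * A i i * (A j 0 :: complex)"
proof -
  have f: "finite {i, j}" "0 \<notin> {i, j}" "finite {j}" "i \<notin> {j}" using assms by auto
  show ?thesis
    unfolding sum_over_permutations_insert[OF f(1,2)] sum_over_permutations_insert[OF f(3,4)] permutes_sing
    using assms by (simp add: sign_swap_id permutation_swap_id sign_compose swap_id_eq)
qed

lemma minor_span_monomial_Q:
  assumes \<alpha>: "set_mset \<alpha> \<subseteq> {1..n}" "size \<alpha> = n - 2" and ij: "i \<in> {1..n}" "j \<in> {1..n}" "i \<noteq> j"
  shows "minor_span n (\<lambda>y h. monom_fun \<alpha> y * Qf y h i j i j)"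
proof -
  let ?W = "{i, j}"
  obtain p where p: "\<And>v. v \<in> {1..n} \<Longrightarrow> p v \<in> {1..n} \<and> p (p v) = p v" "\<And>v. v \<in> ?W \<Longrightarrow> p v = v"
    "image_mset p (mset_set ({1..n} - ?W)) = \<alpha>"
    by (rule ex_forest[of ?W n \<alpha>]) (use assms in auto)
  define e where "e = (\<lambda>t. if t = 0 then (i, j) else (t, p t))"
  obtain c where c: "c \<noteq> 0"
    "\<And>y h. minor n e y h = c * (\<Prod>v\<in>{1..n} - ?W. y (p v)) *
       (\<Sum>\<pi> | \<pi> permutes insert 0 ?W. of_int (sign \<pi>) * (\<Prod>r\<in>insert 0 ?W. col_entry y h r (e (\<pi> r))))"
    by (rule minor_forest[of n p ?W "(i, j)" e]) (use p(1,2) ij e_def in auto)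
  have "i \<noteq> 0" "j \<noteq> 0" using ij by auto
  \<comment> \<open>The block on rows 0, i, j has the columns (h_ij, y_j, y_i), (h_ii, 2 y_i, 0) and
    (h_jj, 0, 2 y_j); its determinant is -2 Q_ij;ij.\<close>
  have "minor n e y h = c * monom_fun \<alpha> y * (-2 * Qf y h i j i j)" if "\<And>i j. h i j = h j i" for y h
    unfolding c(2) prod_eq_monom_fun[OF p(3)]
      leibniz_sum_3[OF \<open>i \<noteq> 0\<close>[symmetric] \<open>j \<noteq> 0\<close>[symmetric] ij(3), of "\<lambda>r t. col_entry y h r (e t)"]
    using ij \<open>i \<noteq> 0\<close> \<open>j \<noteq> 0\<close> p(2)[of i] p(2)[of j] that[of j i]
    by (simp add: e_def col_entry_def Qf_def algebra_simps)
  then have "(- 1 / (2 * c)) * minor n e y h = monom_fun \<alpha> y * Qf y h i j i j" if "\<And>i j. h i j = h j i" for y h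
    using c(1) that by simp
  moreover have "minor_span n (minor n e)"
    by (rule minor_span.minor) (use ij p(1) in \<open>auto simp: e_def\<close>)
  ultimately show ?thesis
    using minor_span.cong[OF minor_span.scale[of n "minor n e" "- 1 / (2 * c)"]] by simp
qed

text \<open>The monomial \<alpha> collects the variables split off from p during the induction; when
  a constant is reached it has the full degree m.\<close>

lemma minor_span_hom_poly:
  assumes mono: "\<And>\<alpha>. set_mset \<alpha> \<subseteq> {1..n} \<Longrightarrow> size \<alpha> = m \<Longrightarrow> minor_span n (\<lambda>y h. monom_fun \<alpha> y * G y h)"
    and "hom_poly n d p"
  shows "set_mset \<alpha> \<subseteq> {1..n} \<Longrightarrow> size \<alpha> + d = m \<Longrightarrow> minor_span n (\<lambda>y h. monom_fun \<alpha> y * p y * G y h)"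
  using assms(2)
proof (induction arbitrary: \<alpha> rule: hom_poly.induct)
  case (const c)
  then show ?case using minor_span.scale[OF mono[of \<alpha>], of c] by (simp add: mult_ac)
next
  case (zero d)
  then show ?case using minor_span.zero by simp
next
  case (add d p q)
  then show ?case
    using minor_span.add[of n "\<lambda>y h. monom_fun \<alpha> y * p y * G y h" "\<lambda>y h. monom_fun \<alpha> y * q y * G y h"]
    by (simp add: algebra_simps)
next
  case (times k d p)
  then show ?case using times.IH[of "add_mset k \<alpha>"] by (simp add: mult_ac)
qed

lemma minor_span_hom_poly_Q:
  assumes "hom_poly n (n - 2) p" "i \<in> {1..n}" "j \<in> {1..n}"
  shows "minor_span n (\<lambda>y h. p y * Qf y h i j i j)"
proof (cases "i = j")
  case True
  then show ?thesis using minor_span.zero by (simp add: Qf_def)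
next
  case False
  then show ?thesis
    using minor_span_hom_poly[OF minor_span_monomial_Q assms(1), where \<alpha> = "{#}"] assms by simp
qed

section \<open>Transvections\<close>

definition trans_y :: "nat \<Rightarrow> nat \<Rightarrow> (nat \<Rightarrow> complex) \<Rightarrow> nat \<Rightarrow> complex" where
  "trans_y i k y = y(i := y i + y k)"

text \<open>The matrix of the bilinear form h after e_i is replaced by e_i + e_k, matching what
  \<open>trans_y\<close> does to the linear form y.\<close>

definition trans_h :: "nat \<Rightarrow> nat \<Rightarrow> (nat \<Rightarrow> nat \<Rightarrow> complex) \<Rightarrow> nat \<Rightarrow> nat \<Rightarrow> complex" where
  "trans_h i k h a b = h a b + (if a = i then h k b else 0) + (if b = i then h a k else 0)
     + (if a = i \<and> b = i then h k k else 0)"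

lemma trans_h_sym: "(\<And>a b. h a b = h b a) \<Longrightarrow> trans_h i k h a b = trans_h i k h b a"
  unfolding trans_h_def by auto

lemma sqdet_sum_columns:
  assumes "\<And>t. t \<le> n \<Longrightarrow> finite (S t)"
  shows "sqdet n (\<lambda>r t. \<Sum>c\<in>S t. f r c) = (\<Sum>g\<in>PiE {0..n} S. sqdet n (\<lambda>r t. f r (g t)))"
proof -
  have col: "sqdet n A = (\<Sum>\<pi> | \<pi> permutes {0..n}. of_int (sign \<pi>) * (\<Prod>t=0..n. A (\<pi> t) t))" for A
  proof -
    have "sqdet n A = (\<Sum>\<pi> | \<pi> permutes {0..<Suc n}. of_int (sign \<pi>) *
        (\<Prod>t<Suc n. Matrix.mat (Suc n) (Suc n) (\<lambda>(r, t). A r t) $$ (\<pi> t, t)))"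
      by (rule det_col) simp
    also have "\<dots> = (\<Sum>\<pi> | \<pi> permutes {0..<Suc n}. of_int (sign \<pi>) * (\<Prod>t<Suc n. A (\<pi> t) t))"
    proof (intro sum.cong refl arg_cong2[where f = "(*)"] prod.cong)
      fix \<pi> t assume "\<pi> \<in> {\<pi>. \<pi> permutes {0..<Suc n}}" "t \<in> {..<Suc n}"
      then have "\<pi> t < Suc n" using permutes_in_image[of \<pi> "{0..<Suc n}" t] by simp
      then show "Matrix.mat (Suc n) (Suc n) (\<lambda>(r, t). A r t) $$ (\<pi> t, t) = A (\<pi> t) t"
        using \<open>t \<in> _\<close> by simp
    qed
    finally show ?thesis unfolding atLeast0LessThan[symmetric] atLeastLessThanSuc_atLeastAtMost .
  qed
  have "sqdet n (\<lambda>r t. \<Sum>c\<in>S t. f r c)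
      = (\<Sum>\<pi> | \<pi> permutes {0..n}. of_int (sign \<pi>) * (\<Sum>g\<in>PiE {0..n} S. \<Prod>t=0..n. f (\<pi> t) (g t)))"
    unfolding col by (intro sum.cong refl arg_cong2[where f = "(*)"] prod_sum_PiE) (use assms in auto)
  also have "\<dots> = (\<Sum>g\<in>PiE {0..n} S. sqdet n (\<lambda>r t. f r (g t)))"
    unfolding col sum_distrib_left by (rule sum.swap)
  finally show ?thesis .
qed

text \<open>Bilinearity of a column turns an index i into the sum over i and k. In the lower rows
  this holds once row i has been added to row k, which does not change the determinant;
  multilinearity in the columns then expands the result into minors.\<close>

lemma minor_trans:
  assumes ik: "i \<in> {1..n}" "k \<in> {1..n}" "i \<noteq> k" and e: "\<And>t. t \<le> n \<Longrightarrow> e t \<in> {0..n} \<times> {1..n}"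
  defines "T \<equiv> \<lambda>a. if a = i then {i, k} else {a :: nat}"
  shows "minor n e (trans_y i k y) (trans_h i k h)
    = (\<Sum>g\<in>PiE {0..n} (\<lambda>t. T (fst (e t)) \<times> T (snd (e t))). minor n g y h)"
proof -
  let ?c = "col_entry (trans_y i k y) (trans_h i k h)"
  let ?M = "Matrix.mat (Suc n) (Suc n) (\<lambda>(r, t). ?c r (e t))"
  have entry: "(if r = k then ?c i (e t) + ?c k (e t) else ?c r (e t))
      = (\<Sum>c\<in>T (fst (e t)) \<times> T (snd (e t)). col_entry y h r c)" if rt: "r \<le> n" "t \<le> n" for r t
  proof -
    obtain a b where ab: "e t = (a, b)" "b \<noteq> 0" using e[OF rt(2)] by (cases "e t") auto
    have "i \<noteq> 0" "k \<noteq> 0" using ik by auto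
    have "(\<Sum>c\<in>T a \<times> T b. col_entry y h r c) = (\<Sum>a'\<in>T a. \<Sum>b'\<in>T b. col_entry y h r (a', b'))"
      by (simp add: sum.cartesian_product)
    then show ?thesis
      unfolding ab fst_conv snd_conv using ik \<open>i \<noteq> 0\<close> \<open>k \<noteq> 0\<close> \<open>b \<noteq> 0\<close>
      by (cases "a = i"; cases "b = i") (auto simp: T_def col_entry_def trans_y_def trans_h_def)
  qed
  have "minor n e (trans_y i k y) (trans_h i k h) = Determinant.det (addrow 1 k i ?M)"
    unfolding minor_def by (rule det_addrow[where n = "Suc n", symmetric]) (use ik in auto)
  also have "addrow 1 k i ?M = Matrix.mat (Suc n) (Suc n) (\<lambda>(r, t).
      \<Sum>c\<in>T (fst (e t)) \<times> T (snd (e t)). col_entry y h r c)"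
  proof (rule eq_matI)
    fix r t assume "r < dim_row (Matrix.mat (Suc n) (Suc n) (\<lambda>(r, t). \<Sum>c\<in>T (fst (e t)) \<times> T (snd (e t)). col_entry y h r c))"
      and "t < dim_col (Matrix.mat (Suc n) (Suc n) (\<lambda>(r, t). \<Sum>c\<in>T (fst (e t)) \<times> T (snd (e t)). col_entry y h r c))"
    then have rt: "r \<le> n" "t \<le> n" by auto
    then show "addrow 1 k i ?M $$ (r, t) = Matrix.mat (Suc n) (Suc n) (\<lambda>(r, t).
        \<Sum>c\<in>T (fst (e t)) \<times> T (snd (e t)). col_entry y h r c) $$ (r, t)"
      using ik entry[OF rt] by (simp add: mat_addrow_def split: if_splits)
  qed auto
  also have "Determinant.det \<dots> = (\<Sum>g\<in>PiE {0..n} (\<lambda>t. T (fst (e t)) \<times> T (snd (e t))). minor n g y h)"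
    unfolding minor_def by (rule sqdet_sum_columns) (auto simp: T_def)
  finally show ?thesis .
qed

lemma minor_span_trans:
  assumes ik: "i \<in> {1..n}" "k \<in> {1..n}" "i \<noteq> k" and "minor_span n P"
  shows "minor_span n (\<lambda>y h. P (trans_y i k y) (trans_h i k h))"
  using assms(4)
proof (induction rule: minor_span.induct)
  case (minor e)
  let ?T = "\<lambda>a. if a = i then {i, k} else {a}"
  have "minor_span n (minor n g)" if g: "g \<in> PiE {0..n} (\<lambda>t. ?T (fst (e t)) \<times> ?T (snd (e t)))" for g
  proof (rule minor_span.minor)
    fix t assume t: "t \<le> n"
    with g have "g t \<in> ?T (fst (e t)) \<times> ?T (snd (e t))" by (auto simp: PiE_iff)
    with minor[OF t] ik show "g t \<in> {0..n} \<times> {1..n}"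
      by (cases "g t") (auto split: if_splits)
  qed
  then show ?case
    by (subst minor_trans[OF ik]) (auto intro: minor minor_span_sum)
next
  case (cong P P')
  show ?case
    by (rule minor_span.cong[OF cong.IH]) (use cong.hyps(2) trans_h_sym in blast)
qed (auto intro: minor_span.intros)

text \<open>The coefficient is twisted beforehand by the inverse substitution, so that after the
  transvection it is p again and only the Q factor has changed.\<close>

lemma hom_poly_untrans:
  assumes "hom_poly n d p" "k \<in> {1..n}"
  obtains q where "hom_poly n d q" "\<And>y. i \<noteq> k \<Longrightarrow> q (trans_y i k y) = p y"
proof (rule that)
  show "hom_poly n d (\<lambda>y. p (y(i := y i - y k)))"
  proof (rule hom_poly_linear_subst[OF assms(1)])
    show "hom_poly n 1 (\<lambda>y. (y(i := y i - y k)) l)" if "l \<in> {1..n}" for l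
      using that assms(2) by (cases "l = i") (auto intro!: hom_poly_var hom_poly_diff)
  qed
qed (simp add: trans_y_def)

section \<open>Polarisation of Q and the Bianchi identity\<close>

lemma minor_span_Q3:
  assumes p: "hom_poly n (n - 2) p" and idx: "i \<in> {1..n}" "j \<in> {1..n}" "k \<in> {1..n}"
  shows "minor_span n (\<lambda>y h. p y * Qf y h i j k j)"
proof -
  consider "i = k" | "i = j \<or> k = j" | "i \<noteq> k" "i \<noteq> j" "k \<noteq> j" by blast
  then show ?thesis
  proof cases
    case 1
    then show ?thesis using minor_span_hom_poly_Q[OF p idx(1,2)] by simp
  next
    case 2
    then have "Qf y h i j k j = 0" for y h by (auto simp: Qf_def)
    then show ?thesis using minor_span.zero by simp
  next
    case 3
    obtain q where q: "hom_poly n (n - 2) q" "\<And>y. q (trans_y i k y) = p y"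
      using hom_poly_untrans[OF p idx(3), of i] 3 by metis
    \<comment> \<open>As a quadratic form in the index i, Q_ij;ij acquires the mixed terms Q_ij;kj +
      Q_kj;ij, which coincide by symmetry of h. Removing the two pure terms and halving isolates
      Q_ij;kj.\<close>
    have "minor_span n (\<lambda>y h. 1/2 * (q (trans_y i k y) * Qf (trans_y i k y) (trans_h i k h) i j i j)
        + ((-1/2) * (p y * Qf y h i j i j) + (-1/2) * (p y * Qf y h k j k j)))"
      using 3 idx
      by (intro minor_span.add minor_span.scale minor_span_trans[where P = "\<lambda>y h. q y * Qf y h i j i j"]
          minor_span_hom_poly_Q p q(1)) auto
    then show ?thesis
    proof (rule minor_span.cong)
      fix y :: "nat \<Rightarrow> complex" and h :: "nat \<Rightarrow> nat \<Rightarrow> complex"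
      assume sym: "\<And>i j. h i j = h j i"
      have "Qf (trans_y i k y) (trans_h i k h) i j i j = Qf y h i j i j + 2 * Qf y h i j k j + Qf y h k j k j"
        using 3 sym[of j i] sym[of k i] sym[of k j] by (simp add: Qf_def trans_y_def trans_h_def algebra_simps)
      then show "1/2 * (q (trans_y i k y) * Qf (trans_y i k y) (trans_h i k h) i j i j)
        + ((-1/2) * (p y * Qf y h i j i j) + (-1/2) * (p y * Qf y h k j k j)) = p y * Qf y h i j k j"
        by (simp add: q(2) algebra_simps)
    qed
  qed
qed

text \<open>Polarisation of Q_ij;kj in j. Since i and k differ from j, the substitution reaches only
  the two places where j stands.\<close>

lemma minor_span_Q4:
  assumes p: "hom_poly n (n - 2) p" and idx: "i \<in> {1..n}" "j \<in> {1..n}" "k \<in> {1..n}" "l \<in> {1..n}"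
    and dist: "i \<noteq> j" "k \<noteq> j" "l \<noteq> j"
  shows "minor_span n (\<lambda>y h. p y * (Qf y h i l k j + Qf y h i j k l))"
proof -
  obtain q where q: "hom_poly n (n - 2) q" "\<And>y. q (trans_y j l y) = p y"
    using hom_poly_untrans[OF p idx(4), of j] dist by metis
  have "minor_span n (\<lambda>y h. q (trans_y j l y) * Qf (trans_y j l y) (trans_h j l h) i j k j
      + ((-1) * (p y * Qf y h i j k j) + (-1) * (p y * Qf y h i l k l)))"
    using dist idx
    by (intro minor_span.add minor_span.scale minor_span_trans[where P = "\<lambda>y h. q y * Qf y h i j k j"]
        minor_span_Q3 p q(1)) auto
  then show ?thesis
  proof (rule minor_span.cong)
    fix y :: "nat \<Rightarrow> complex" and h :: "nat \<Rightarrow> nat \<Rightarrow> complex"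
    have "Qf (trans_y j l y) (trans_h j l h) i j k j = Qf y h i j k j + Qf y h i l k j + Qf y h i j k l + Qf y h i l k l"
      using dist by (simp add: Qf_def trans_y_def trans_h_def algebra_simps)
    then show "q (trans_y j l y) * Qf (trans_y j l y) (trans_h j l h) i j k j
      + ((-1) * (p y * Qf y h i j k j) + (-1) * (p y * Qf y h i l k l)) = p y * (Qf y h i l k j + Qf y h i j k l)"
      by (simp add: q(2) algebra_simps)
  qed
qed

lemma minor_span_Q:
  assumes p: "hom_poly n (n - 2) p" and idx: "i \<in> {1..n}" "j \<in> {1..n}" "k \<in> {1..n}" "l \<in> {1..n}"
  shows "minor_span n (\<lambda>y h. p y * Qf y h i j k l)"
proof -
  have neg: "minor_span n (\<lambda>y h. p y * Qf y h a b c d)" if "minor_span n (\<lambda>y h. p y * Qf y h b a c d)" for a b c d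
    using minor_span.scale[OF that, of "-1"] by (simp add: Qf_def algebra_simps)
  have neg': "minor_span n (\<lambda>y h. p y * Qf y h a b c d)" if "minor_span n (\<lambda>y h. p y * Qf y h a b d c)" for a b c d
    using minor_span.scale[OF that, of "-1"] by (simp add: Qf_def algebra_simps)
  consider "i = j \<or> k = l" | "j = l" | "i = l" | "j = k" | "i = k"
    | "i \<noteq> j" "i \<noteq> k" "i \<noteq> l" "j \<noteq> k" "j \<noteq> l" "k \<noteq> l" by blast
  then show ?thesis
  proof cases
    case 1
    then have "Qf y h i j k l = 0" for y h by (auto simp: Qf_def)
    then show ?thesis using minor_span.zero by simp
  next
    case 2
    then show ?thesis using minor_span_Q3[OF p idx(1,2,3)] by simp
  next
    case 3
    then show ?thesis using neg[OF minor_span_Q3[OF p idx(2,1,3)]] by simp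
  next
    case 4
    then show ?thesis using neg'[OF minor_span_Q3[OF p idx(1,2,4)]] by simp
  next
    case 5
    then show ?thesis using neg[OF neg'[OF minor_span_Q3[OF p idx(2,1,4)]]] by simp
  next
    case 6
    \<comment> \<open>Let a = Q_ij;kl, b = Q_jk;il, c = Q_ki;jl. For symmetric h the two brackets
      are a - b and b - c, and a + b + c = 0 is the Bianchi identity; so the combination equals (2 a
      - b - c) / 3 = a.\<close>
    have "minor_span n (\<lambda>y h. 2/3 * (p y * (Qf y h i l k j + Qf y h i j k l)) + 1/3 * (p y * (Qf y h j l i k + Qf y h j k i l)))"
      using 6 idx by (intro minor_span.add minor_span.scale minor_span_Q4 p) auto
    then show ?thesis
    proof (rule minor_span.cong)
      fix y :: "nat \<Rightarrow> complex" and h :: "nat \<Rightarrow> nat \<Rightarrow> complex"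
      assume sym: "\<And>i j. h i j = h j i"
      show "2/3 * (p y * (Qf y h i l k j + Qf y h i j k l)) + 1/3 * (p y * (Qf y h j l i k + Qf y h j k i l))
          = p y * Qf y h i j k l"
        using sym[of j i] sym[of k i] sym[of l i] sym[of k j] sym[of l j] sym[of l k]
        by (simp add: Qf_def field_simps)
    qed
  qed
qed

section \<open>Powers and products of ideals\<close>

context cring
begin

text \<open>The ideal quotient K : a. It turns the question which multiples of a lie in K into
  containment in an ideal, which can be tested on generators.\<close>

lemma colon_ideal:
  assumes K: "ideal K R" and a: "a \<in> carrier R"
  shows "ideal {x \<in> carrier R. x \<otimes> a \<in> K} R"
proof (rule idealI[OF ring_axioms])
  interpret K: ideal K R by fact
  show "subgroup {x \<in> carrier R. x \<otimes> a \<in> K} (add_monoid R)"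
  proof (rule add.subgroupI)
    show "{x \<in> carrier R. x \<otimes> a \<in> K} \<noteq> {}"
    proof -
      have "\<zero> \<in> {x \<in> carrier R. x \<otimes> a \<in> K}" using a K.zero_closed by simp
      then show ?thesis by blast
    qed
    show "\<ominus> x \<in> {x \<in> carrier R. x \<otimes> a \<in> K}" if "x \<in> {x \<in> carrier R. x \<otimes> a \<in> K}" for x
      using that a by (simp add: l_minus K.a_inv_closed)
  qed (use a in \<open>auto simp: l_distr K.a_closed\<close>)
next
  fix b x assume b: "b \<in> {x \<in> carrier R. x \<otimes> a \<in> K}" and x: "x \<in> carrier R"
  then have "(x \<otimes> b) \<otimes> a \<in> K"
    using a ideal.I_l_closed[OF K] by (simp add: m_assoc)
  then show "x \<otimes> b \<in> {x \<in> carrier R. x \<otimes> a \<in> K}" "b \<otimes> x \<in> {x \<in> carrier R. x \<otimes> a \<in> K}"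
    using b x by (simp_all add: m_comm[of b x])
qed

lemma ideal_power_0: "ideal_power R I 0 = carrier R"
  by (simp add: nat_pow_def ideals_set_def)

lemma ideal_power_Suc: "ideal_power R I (Suc k) = ideal_prod R (ideal_power R I k) I"
  by (simp add: nat_pow_def ideals_set_def)

lemma ideal_power_ideal: "ideal I R \<Longrightarrow> ideal (ideal_power R I k) R"
proof (induction k)
  case 0
  show ?case unfolding ideal_power_0 by (rule oneideal)
next
  case (Suc k)
  then show ?case unfolding ideal_power_Suc by (intro ideal_prod_is_ideal)
qed

lemma ideal_prod_Idl_subset:
  assumes K: "ideal K R" and I: "I \<subseteq> carrier R" and G: "G \<subseteq> carrier R"
    and gen: "\<And>g. g \<in> G \<Longrightarrow> I \<subseteq> {x \<in> carrier R. x \<otimes> g \<in> K}"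
  shows "ideal_prod R I (Idl G) \<subseteq> K"
proof
  interpret K: ideal K R by fact
  fix s assume "s \<in> ideal_prod R I (Idl G)"
  then show "s \<in> K"
  proof (induction rule: ideal_prod.induct)
    case (prod i j)
    have i: "i \<in> carrier R" using prod I by blast
    have "Idl G \<subseteq> {x \<in> carrier R. x \<otimes> i \<in> K}"
    proof (rule genideal_minimal[OF colon_ideal[OF K i]])
      show "G \<subseteq> {x \<in> carrier R. x \<otimes> i \<in> K}"
      proof
        fix g assume g: "g \<in> G"
        then have "i \<otimes> g \<in> K" "g \<in> carrier R" using gen[OF g] prod(1) G by auto
        then show "g \<in> {x \<in> carrier R. x \<otimes> i \<in> K}" using i by (simp add: m_comm)
      qed
    qed
    with prod(2) i show ?case by (auto simp: m_comm)
  qed (rule K.a_closed)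
qed

lemma ideal_power_Idl_subset:
  assumes "ideal K R" and G: "G \<subseteq> carrier R"
    and "\<And>gs. set gs \<subseteq> G \<Longrightarrow> length gs = k \<Longrightarrow> foldr (\<otimes>) gs \<one> \<in> K"
  shows "ideal_power R (Idl G) k \<subseteq> K"
  using assms(1,3)
proof (induction k arbitrary: K)
  case 0
  interpret K: ideal K R by fact
  have "\<one> \<in> K" using 0(2)[of "[]"] by simp
  then show ?case unfolding ideal_power_0 using K.one_imp_carrier by blast
next
  case (Suc k)
  have fold: "foldr (\<otimes>) gs \<one> \<in> carrier R" if "set gs \<subseteq> G" for gs
    using that G by (induction gs) auto
  show ?case
    unfolding ideal_power_Suc
  proof (rule ideal_prod_Idl_subset[OF Suc.prems(1) _ G])
    show "ideal_power R (Idl G) k \<subseteq> carrier R"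
      by (rule subsetI) (rule ideal.Icarr[OF ideal_power_ideal[OF genideal_ideal[OF G]]])
    fix g assume g: "g \<in> G"
    then have gc: "g \<in> carrier R" using G by blast
    \<comment> \<open>Splitting off the factor g replaces the target K by the quotient K : g; the
      induction therefore runs over all target ideals.\<close>
    show "ideal_power R (Idl G) k \<subseteq> {x \<in> carrier R. x \<otimes> g \<in> K}"
    proof (rule Suc.IH[OF colon_ideal[OF Suc.prems(1) gc]])
      fix gs assume gs: "set gs \<subseteq> G" "length gs = k"
      then have "foldr (\<otimes>) (g # gs) \<one> \<in> K" using g by (intro Suc.prems(2)) auto
      then show "foldr (\<otimes>) gs \<one> \<in> {x \<in> carrier R. x \<otimes> g \<in> K}"
        using fold[OF gs(1)] gc by (simp add: m_comm)
    qed
  qed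
qed

lemma subset_set_add:
  assumes "ideal I R" "ideal J R" shows "I \<subseteq> I <+>\<^bsub>R\<^esub> J" "J \<subseteq> I <+>\<^bsub>R\<^esub> J"
proof -
  have "I \<union> J \<subseteq> carrier R" using ideal.Icarr[OF assms(1)] ideal.Icarr[OF assms(2)] by auto
  then show "I \<subseteq> I <+>\<^bsub>R\<^esub> J" "J \<subseteq> I <+>\<^bsub>R\<^esub> J"
    using genideal_self[of "I \<union> J"] union_genideal[OF assms] by auto
qed

lemma set_add_subset:
  assumes "ideal I R" "ideal J R" "ideal K R" "I \<subseteq> K" "J \<subseteq> K" shows "I <+>\<^bsub>R\<^esub> J \<subseteq> K"
  using genideal_minimal[OF assms(3), of "I \<union> J"] union_genideal[OF assms(1,2)] assms(4,5) by auto

end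

section \<open>The ring of holomorphic functions\<close>

lemma holomorphic_multi_cong:
  assumes U: "open U" and eq: "\<And>x. x \<in> U \<Longrightarrow> f x = g x" and f: "holomorphic_multi f U"
  shows "holomorphic_multi g U"
  unfolding holomorphic_multi_def
proof
  fix x assume x: "x \<in> U"
  then obtain D where D: "(f has_derivative D) (at x)" "\<forall>c v. D (c *s v) = c * D v"
    using f unfolding holomorphic_multi_def by blast
  have "(g has_derivative D) (at x)"
    by (rule has_derivative_transform_within_open[OF D(1) U x]) (rule eq)
  with D(2) show "\<exists>D. (g has_derivative D) (at x) \<and> (\<forall>c v. D (c *s v) = c * D v)" by blast
qed

lemma holomorphic_multi_restrict:
  "open U \<Longrightarrow> holomorphic_multi (restrict f U) U \<longleftrightarrow> holomorphic_multi f U"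
  using holomorphic_multi_cong[of U f "restrict f U"] holomorphic_multi_cong[of U "restrict f U" f] by auto

lemma holomorphic_multi_const: "holomorphic_multi (\<lambda>_. c) U"
  unfolding holomorphic_multi_def by (intro ballI exI[of _ "\<lambda>_. 0"]) auto

lemma holomorphic_multi_add:
  assumes "holomorphic_multi f U" "holomorphic_multi g U"
  shows "holomorphic_multi (\<lambda>x. f x + g x) U"
  unfolding holomorphic_multi_def
proof
  fix x assume x: "x \<in> U"
  obtain D where D: "(f has_derivative D) (at x)" "\<forall>c v. D (c *s v) = c * D v"
    using assms(1) x unfolding holomorphic_multi_def by blast
  obtain D' where D': "(g has_derivative D') (at x)" "\<forall>c v. D' (c *s v) = c * D' v"
    using assms(2) x unfolding holomorphic_multi_def by blast
  show "\<exists>D. ((\<lambda>x. f x + g x) has_derivative D) (at x) \<and> (\<forall>c v. D (c *s v) = c * D v)"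
    using has_derivative_add[OF D(1) D'(1)] D(2) D'(2)
    by (intro exI[of _ "\<lambda>v. D v + D' v"]) (simp add: distrib_left)
qed

lemma holomorphic_multi_mult:
  assumes "holomorphic_multi f U" "holomorphic_multi g U"
  shows "holomorphic_multi (\<lambda>x. f x * g x) U"
  unfolding holomorphic_multi_def
proof
  fix x assume x: "x \<in> U"
  obtain D where D: "(f has_derivative D) (at x)" "\<forall>c v. D (c *s v) = c * D v"
    using assms(1) x unfolding holomorphic_multi_def by blast
  obtain D' where D': "(g has_derivative D') (at x)" "\<forall>c v. D' (c *s v) = c * D' v"
    using assms(2) x unfolding holomorphic_multi_def by blast
  show "\<exists>D. ((\<lambda>x. f x * g x) has_derivative D) (at x) \<and> (\<forall>c v. D (c *s v) = c * D v)"
    using has_derivative_mult[OF D(1) D'(1)] D(2) D'(2)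
    by (intro exI[of _ "\<lambda>v. f x * D' v + D v * g x"]) (simp add: algebra_simps)
qed

lemma restrict_in_holo_ring:
  "open U \<Longrightarrow> restrict f U \<in> carrier (holo_ring U) \<longleftrightarrow> holomorphic_multi f U"
  by (simp add: holo_ring_def holomorphic_multi_restrict)

lemma holo_ring_mult_restrict:
  "restrict f U \<otimes>\<^bsub>holo_ring U\<^esub> restrict g U = restrict (\<lambda>x. f x * g x) U"
  by (auto simp: holo_ring_def)

lemma holo_ring_add_restrict:
  "restrict f U \<oplus>\<^bsub>holo_ring U\<^esub> restrict g U = restrict (\<lambda>x. f x + g x) U"
  by (auto simp: holo_ring_def)

lemma cring_holo_ring:
  assumes U: "open U" shows "cring (holo_ring U)"
proof (rule cringI)
  have hol: "holomorphic_multi f U" if "f \<in> carrier (holo_ring U)" for f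
    using that by (simp add: holo_ring_def)
  have ext: "f \<in> extensional U" if "f \<in> carrier (holo_ring U)" for f
    using that by (simp add: holo_ring_def)
  have add: "f \<oplus>\<^bsub>holo_ring U\<^esub> g = restrict (\<lambda>x. f x + g x) U"
    and mult: "f \<otimes>\<^bsub>holo_ring U\<^esub> g = restrict (\<lambda>x. f x * g x) U"
    and zero: "\<zero>\<^bsub>holo_ring U\<^esub> = restrict (\<lambda>x. 0) U" and one: "\<one>\<^bsub>holo_ring U\<^esub> = restrict (\<lambda>x. 1) U" for f g
    by (simp_all add: holo_ring_def)
  note ops = add mult zero one restrict_in_holo_ring[OF U]
  note hols = holomorphic_multi_add holomorphic_multi_mult holomorphic_multi_const
  show "abelian_group (holo_ring U)"
  proof (rule abelian_groupI)
    fix f assume f: "f \<in> carrier (holo_ring U)"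
    show "\<zero>\<^bsub>holo_ring U\<^esub> \<oplus>\<^bsub>holo_ring U\<^esub> f = f"
      using ext[OF f] by (auto simp: ops extensional_def)
    have "restrict (\<lambda>x. (-1) * f x) U \<in> carrier (holo_ring U)"
      using f by (simp only: ops) (intro hols hol)
    moreover have "restrict (\<lambda>x. (-1) * f x) U \<oplus>\<^bsub>holo_ring U\<^esub> f = \<zero>\<^bsub>holo_ring U\<^esub>"
      by (auto simp: ops)
    ultimately show "\<exists>g\<in>carrier (holo_ring U). g \<oplus>\<^bsub>holo_ring U\<^esub> f = \<zero>\<^bsub>holo_ring U\<^esub>" by blast
  qed (auto simp: ops algebra_simps intro!: hols dest!: hol)
  show "comm_monoid (holo_ring U)"
  proof (rule comm_monoidI)
    show "\<one>\<^bsub>holo_ring U\<^esub> \<otimes>\<^bsub>holo_ring U\<^esub> f = f" if "f \<in> carrier (holo_ring U)" for f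
      using ext[OF that] by (auto simp: ops extensional_def)
  qed (auto simp: ops algebra_simps intro!: hols dest!: hol)
qed (auto simp: holo_ring_def algebra_simps)

section \<open>Columns of the second Jacobian matrix\<close>

lemma jac2_cols_eq: "jac2_cols n = filter (\<lambda>c. c \<noteq> (0, 0)) (concat (map (\<lambda>i. map (Pair i) [i..<Suc n]) [0..<Suc n]))"
proof -
  have *: "concat (map (\<lambda>i. concat (map (\<lambda>j. if (i, j) \<noteq> (0, 0) then [(i, j)] else []) [i..<Suc n])) xs)
      = filter (\<lambda>c. c \<noteq> (0, 0)) (concat (map (\<lambda>i. map (Pair i) [i..<Suc n]) xs))" for xs :: "nat list"
  proof -
    have "concat (map (\<lambda>j. if (i, j) \<noteq> (0, 0) then [(i, j)] else []) ys) = filter (\<lambda>c. c \<noteq> (0, 0)) (map (Pair i) ys)"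
      for i :: nat and ys :: "nat list" by (induction ys) auto
    then show ?thesis by (induction xs) (simp_all only: list.map concat.simps filter.simps filter_append)
  qed
  show ?thesis unfolding jac2_cols_def by (rule *)
qed

lemma set_jac2_cols: "set (jac2_cols n) = {(i, j). i \<le> j \<and> j \<le> n \<and> j \<noteq> 0}"
  by (force simp: jac2_cols_eq simp del: upt_Suc)

lemma distinct_jac2_cols: "distinct (jac2_cols n)"
proof -
  have "distinct (concat (map (\<lambda>i. map (Pair i) [i..<Suc n]) xs))" if "distinct xs" for xs :: "nat list"
    using that by (induction xs) (auto simp: distinct_map inj_on_def simp del: upt_Suc)
  then show ?thesis by (simp add: jac2_cols_eq del: upt_Suc)
qed

lemma length_jac2_cols: "length (jac2_cols n) = n + ((n + 1) choose 2)"
proof -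
  have "length (jac2_cols n) = card (set (jac2_cols n))"
    by (simp add: distinct_card[OF distinct_jac2_cols])
  \<comment> \<open>Counting by the second index: each j from 1 to n admits the j + 1 first indices
    0, ..., j.\<close>
  also have "set (jac2_cols n) = prod.swap ` Sigma {1..n} (\<lambda>j. {..j})"
    by (force simp: set_jac2_cols)
  also have "card \<dots> = (\<Sum>j=1..n. Suc j)"
    by (subst card_image) (auto simp: inj_on_def)
  also have "\<dots> = n + ((n + 1) choose 2)"
    by (induction n) (auto simp: numeral_2_eq_2 One_nat_def)
  finally show ?thesis .
qed

section \<open>Column operations on determinants\<close>

lemma sqdet_permute_columns:
  assumes \<sigma>: "\<sigma> permutes {0..n}"
  shows "sqdet n (\<lambda>r t. B r (\<sigma> t)) = of_int (sign \<sigma>) * sqdet n B"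
proof -
  have "sqdet n B = (\<Sum>\<pi> | \<pi> permutes {0..n}. of_int (sign (\<sigma> \<circ> \<pi>)) * (\<Prod>r=0..n. B r ((\<sigma> \<circ> \<pi>) r)))"
    unfolding sqdet_leibniz by (rule setum_permutations_compose_left[OF \<sigma>])
  also have "\<dots> = (\<Sum>\<pi> | \<pi> permutes {0..n}. of_int (sign \<sigma>) * (of_int (sign \<pi>) * (\<Prod>r=0..n. B r (\<sigma> (\<pi> r)))))"
  proof (intro sum.cong refl)
    fix \<pi> assume "\<pi> \<in> {\<pi>. \<pi> permutes {0..n}}"
    then have "sign (\<sigma> \<circ> \<pi>) = sign \<sigma> * sign \<pi>"
      using \<sigma> by (intro sign_compose) (auto intro: permutes_imp_permutation[of "{0..n}"])
    then show "of_int (sign (\<sigma> \<circ> \<pi>)) * (\<Prod>r=0..n. B r ((\<sigma> \<circ> \<pi>) r))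
        = of_int (sign \<sigma>) * (of_int (sign \<pi>) * (\<Prod>r=0..n. B r (\<sigma> (\<pi> r))))"
      by simp
  qed
  also have "\<dots> = of_int (sign \<sigma>) * sqdet n (\<lambda>r t. B r (\<sigma> t))"
    unfolding sqdet_leibniz by (simp only: sum_distrib_left)
  finally have "of_int (sign \<sigma>) * sqdet n B = of_int (sign \<sigma> * sign \<sigma>) * sqdet n (\<lambda>r t. B r (\<sigma> t))"
    by (simp only: of_int_mult mult.assoc)
  then show ?thesis by (simp del: of_int_mult)
qed

lemma sqdet_scale_columns:
  "sqdet n (\<lambda>r t. c t * A r t) = (\<Prod>t=0..n. c t) * sqdet n A"
proof -
  have "(\<Prod>r=0..n. c (\<pi> r)) = (\<Prod>t=0..n. c t)" if "\<pi> permutes {0..n}" for \<pi>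
    using prod.permute[OF that, of c] by (simp add: o_def)
  then show ?thesis
    unfolding sqdet_leibniz sum_distrib_left
    by (intro sum.cong refl) (simp add: prod.distrib)
qed

lemma sqdet_equal_columns:
  assumes "s \<le> n" "t \<le> n" "s \<noteq> t" "\<And>r. A r s = A r t"
  shows "sqdet n A = 0"
proof -
  have "sqdet n A = sqdet n (\<lambda>r u. A r (Transposition.transpose s t u))"
    by (intro arg_cong[where f = Determinant.det] eq_matI)
       (use assms in \<open>auto simp: Transposition.transpose_def\<close>)
  also have "\<dots> = - sqdet n A"
    by (subst sqdet_permute_columns) (use assms in \<open>auto simp: sign_swap_id intro: permutes_swap_id\<close>)
  finally show ?thesis by simp
qed

lemma sqdet_cong:
  "(\<And>r t. r \<le> n \<Longrightarrow> t \<le> n \<Longrightarrow> A r t = B r t) \<Longrightarrow> sqdet n A = sqdet n B"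
  by (intro arg_cong[where f = Determinant.det] eq_matI) auto

lemma submatrix_jac2:
  assumes "J \<subseteq> {..<n + ((n + 1) choose 2)}" "card J = n + 1"
  shows "Determinant.det (submatrix (jac2 n idx F x) UNIV J) = sqdet n (\<lambda>r t. jac2_entry idx F r (jac2_cols n ! pick J t) x)"
proof -
  have J: "{j. j < n + ((n + 1) choose 2) \<and> j \<in> J} = J" using assms(1) by auto
  have "pick J t < n + ((n + 1) choose 2)" if "t < Suc n" for t
    using pick_in_set_le[of t J] assms that by auto
  then have "submatrix (jac2 n idx F x) UNIV J
      = Matrix.mat (Suc n) (Suc n) (\<lambda>(r, t). jac2_entry idx F r (jac2_cols n ! pick J t) x)"
    using assms(2) by (intro eq_matI) (auto simp: submatrix_def jac2_def J pick_UNIV)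
  then show ?thesis by simp
qed

section \<open>The ideals of a holomorphic function\<close>

locale holomorphic_function =
  fixes n :: nat and idx :: "nat \<Rightarrow> 'n::finite" and U :: "(complex ^ 'n) set" and F :: "complex ^ 'n \<Rightarrow> complex"
  assumes n: "n \<ge> 2" and U: "open U" and F: "holomorphic_multi F U"
begin

abbreviation "R \<equiv> holo_ring U"
abbreviation grad where "grad x \<equiv> \<lambda>k. partial idx k F x"
abbreviation hess where "hess x \<equiv> \<lambda>i j. partial2 idx i j F x"

sublocale cring R by (rule cring_holo_ring[OF U])

lemma holomorphic_grad: "holomorphic_multi (\<lambda>x. grad x k) U"
  unfolding partial_eq_pd by (rule holomorphic_multi_pd_closed[OF F U])

lemma holomorphic_hess: "holomorphic_multi (\<lambda>x. hess x i j) U"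
  unfolding partial2_def partial_eq_pd by (intro holomorphic_multi_pd_closed F U)

lemma hess_sym: "x \<in> U \<Longrightarrow> hess x i j = hess x j i"
  unfolding partial2_def partial_eq_pd by (rule pd_commute[OF F U])

lemma holomorphic_Q: "holomorphic_multi (Q_fun idx F i j k l) U"
proof -
  have "holomorphic_multi (\<lambda>x. hess x i k * grad x j * grad x l + (-1) * (hess x j k * grad x i * grad x l)
      + (-1) * (hess x i l * grad x j * grad x k) + hess x j l * grad x i * grad x k) U"
    by (intro holomorphic_multi_add holomorphic_multi_mult holomorphic_multi_const holomorphic_grad holomorphic_hess)
  then show ?thesis
    by (rule holomorphic_multi_cong[OF U, rotated]) (simp add: Q_fun_def)
qed

lemma Q_fun_eq: "Q_fun idx F i j k l x = Qf (grad x) (hess x) i j k l"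
  by (simp add: Q_fun_def Qf_def)

lemma ideal_add:
  assumes "ideal K R" "restrict f U \<in> K" "restrict g U \<in> K" shows "restrict (\<lambda>x. f x + g x) U \<in> K"
  using additive_subgroup.a_closed[OF ideal.axioms(1)[OF assms(1)] assms(2,3)] by (simp only: holo_ring_add_restrict)

lemma ideal_mult:
  assumes "ideal K R" "holomorphic_multi g U" "restrict f U \<in> K" shows "restrict (\<lambda>x. g x * f x) U \<in> K"
  using ideal.I_l_closed[OF assms(1,3), of "restrict g U"] assms(2)
  by (simp only: holo_ring_mult_restrict restrict_in_holo_ring[OF U])

lemma ideal_zero: "ideal K R \<Longrightarrow> restrict (\<lambda>_. 0) U \<in> K"
  using additive_subgroup.zero_closed[OF ideal.axioms(1), of K R] by (simp add: holo_ring_def)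

lemma ideal_sum:
  "ideal K R \<Longrightarrow> (\<And>i. i \<in> S \<Longrightarrow> restrict (f i) U \<in> K) \<Longrightarrow> restrict (\<lambda>x. \<Sum>i\<in>S. f i x) U \<in> K"
  by (induction S rule: infinite_finite_induct) (simp_all add: ideal_zero ideal_add)

abbreviation "grad_gens \<equiv> {restrict (partial idx k F) U | k. k \<in> {1..n}}"
abbreviation "Q_gens \<equiv> {restrict (Q_fun idx F i j k l) U | i j k l. i \<in> {1..n} \<and> j \<in> {1..n} \<and> k \<in> {1..n} \<and> l \<in> {1..n}}"
abbreviation "I1 \<equiv> jacobian_ideal n idx U F"
abbreviation "IQ \<equiv> Q_ideal n idx U F"
abbreviation "I2 \<equiv> second_jacobian_ideal n idx U F"

lemma gens_carrier: "grad_gens \<subseteq> carrier R" "Q_gens \<subseteq> carrier R"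
  using holomorphic_grad holomorphic_Q by (auto simp: restrict_in_holo_ring[OF U])

lemma ideal_I1: "ideal I1 R" and ideal_IQ: "ideal IQ R"
  unfolding jacobian_ideal_def Q_ideal_def by (intro genideal_ideal gens_carrier)+

lemma hom_poly_in_power:
  "hom_poly n d p \<Longrightarrow> restrict (\<lambda>x. p (grad x)) U \<in> ideal_power R I1 d"
proof (induction rule: hom_poly.induct)
  case (const c)
  show ?case unfolding ideal_power_0 restrict_in_holo_ring[OF U] by (rule holomorphic_multi_const)
next
  case (zero d)
  show ?case by (rule ideal_zero[OF ideal_power_ideal[OF ideal_I1]])
next
  case (add d p q)
  then show ?case by (intro ideal_add ideal_power_ideal ideal_I1)
next
  case (times k d p)
  have "restrict (partial idx k F) U \<in> I1"
    unfolding jacobian_ideal_def using genideal_self[OF gens_carrier(1)] times(1) by blast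
  from ideal_prod.prod[OF times.IH this, of R]
  show ?case unfolding ideal_power_Suc holo_ring_mult_restrict by (simp only: mult.commute)
qed

abbreviation "rhs \<equiv> ideal_power R I1 (n + 1) <+>\<^bsub>R\<^esub> ideal_prod R (ideal_power R I1 (n - 2)) IQ"

lemma ideal_prod_IQ: "ideal (ideal_prod R (ideal_power R I1 (n - 2)) IQ) R"
  by (intro ideal_prod_is_ideal ideal_power_ideal ideal_I1 ideal_IQ)

lemma ideal_rhs: "ideal rhs R"
  by (intro add_ideals ideal_prod_IQ ideal_power_ideal ideal_I1)

section \<open>Minors lie in the sum of the two ideals\<close>

lemma minor_in_rhs:
  assumes e: "\<And>t. t \<le> n \<Longrightarrow> e t \<in> {0..n} \<times> {1..n}"
  shows "restrict (\<lambda>x. minor n e (grad x) (hess x)) U \<in> rhs"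
proof (rule minor_decomposition[OF n e])
  fix p S
  assume p: "hom_poly n (n + 1) p"
    and S: "\<And>i k j l. i \<in> {1..n} \<Longrightarrow> k \<in> {1..n} \<Longrightarrow> j \<in> {1..n} \<Longrightarrow> l \<in> {1..n} \<Longrightarrow> hom_poly n (n - 2) (S i k j l)"
    and eq: "\<And>y h. (\<And>i j. h i j = h j i) \<Longrightarrow> minor n e y h
       = p y + (\<Sum>i=1..n. \<Sum>k=1..n. \<Sum>j=1..n. \<Sum>l=1..n. S i k j l y * Qf y h i k j l)"
  have summand: "restrict (\<lambda>x. S i k j l (grad x) * Q_fun idx F i k j l x) U \<in> rhs"
    if idx: "i \<in> {1..n}" "k \<in> {1..n}" "j \<in> {1..n}" "l \<in> {1..n}" for i k j l
  proof -
    have "restrict (Q_fun idx F i k j l) U \<in> IQ"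
      unfolding Q_ideal_def using genideal_self[OF gens_carrier(2)] idx by blast
    from ideal_prod.prod[OF hom_poly_in_power[OF S[OF idx]] this, of R]
    show ?thesis
      unfolding holo_ring_mult_restrict
      using subset_set_add(2)[OF ideal_power_ideal[OF ideal_I1] ideal_prod_IQ] by blast
  qed
  have "restrict (\<lambda>x. p (grad x)) U \<in> rhs"
    using hom_poly_in_power[OF p] subset_set_add(1)[OF ideal_power_ideal[OF ideal_I1] ideal_prod_IQ] by blast
  moreover have "restrict (\<lambda>x. \<Sum>i=1..n. \<Sum>k=1..n. \<Sum>j=1..n. \<Sum>l=1..n. S i k j l (grad x) * Q_fun idx F i k j l x) U \<in> rhs"
    by (intro ideal_sum ideal_rhs) (rule summand)
  ultimately have "restrict (\<lambda>x. p (grad x) + (\<Sum>i=1..n. \<Sum>k=1..n. \<Sum>j=1..n. \<Sum>l=1..n.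
      S i k j l (grad x) * Q_fun idx F i k j l x)) U \<in> rhs"
    by (rule ideal_add[OF ideal_rhs])
  also have "restrict (\<lambda>x. p (grad x) + (\<Sum>i=1..n. \<Sum>k=1..n. \<Sum>j=1..n. \<Sum>l=1..n.
      S i k j l (grad x) * Q_fun idx F i k j l x)) U = restrict (\<lambda>x. minor n e (grad x) (hess x)) U"
    by (intro restrict_ext) (simp only: eq[OF hess_sym] Q_fun_eq)
  finally show ?thesis .
qed

definition dbl :: "nat \<times> nat \<Rightarrow> complex" where
  "dbl c = (if fst c = snd c then 2 else 1)"

text \<open>\<open>dbl\<close> undoes the halved loop columns of the matrix, and symmetry of the
  Hessian undoes the order of the pair, which is why x is taken in U.\<close>

lemma col_entry_eq:
  assumes "snd c \<noteq> 0" "x \<in> U"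
  shows "col_entry (grad x) (hess x) r c = dbl c * jac2_entry idx F r (min (fst c) (snd c), max (fst c) (snd c)) x"
  using assms hess_sym[OF assms(2), of "fst c" "snd c"]
  by (auto simp: col_entry_def dbl_def min_def max_def)

abbreviation "minor_gens \<equiv> {(\<lambda>x\<in>U. Determinant.det (submatrix (jac2 n idx F x) UNIV J)) | J.
          J \<subseteq> {..<n + ((n + 1) choose 2)} \<and> card J = n + 1}"

lemma minor_gens_rhs: "minor_gens \<subseteq> rhs"
proof
  fix f assume "f \<in> minor_gens"
  then obtain J where J: "J \<subseteq> {..<n + ((n + 1) choose 2)}" "card J = n + 1"
    and f: "f = restrict (\<lambda>x. Determinant.det (submatrix (jac2 n idx F x) UNIV J)) U" by blast
  define e where "e t = jac2_cols n ! pick J t" for t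
  have e: "fst (e t) \<le> snd (e t)" "snd (e t) \<le> n" "snd (e t) \<noteq> 0" if "t \<le> n" for t
  proof -
    have "e t \<in> set (jac2_cols n)"
      unfolding e_def using pick_in_set_le[of t J] J that by (intro nth_mem) (auto simp: length_jac2_cols)
    then show "fst (e t) \<le> snd (e t)" "snd (e t) \<le> n" "snd (e t) \<noteq> 0" by (auto simp: set_jac2_cols)
  qed
  define c where "c = (\<Prod>t=0..n. dbl (e t))"
  have "c \<noteq> 0" by (simp add: c_def dbl_def)
  have "minor n e (grad x) (hess x) = c * Determinant.det (submatrix (jac2 n idx F x) UNIV J)" if x: "x \<in> U" for x
    unfolding minor_def submatrix_jac2[OF J] c_def sqdet_scale_columns[symmetric]
  proof (rule sqdet_cong)
    fix r t assume t: "t \<le> n"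
    have "(min (fst (e t)) (snd (e t)), max (fst (e t)) (snd (e t))) = e t"
      using e(1)[OF t] by (simp add: min_def max_def)
    with col_entry_eq[OF e(3)[OF t] x, of r]
    show "col_entry (grad x) (hess x) r (e t) = dbl (e t) * jac2_entry idx F r (jac2_cols n ! pick J t) x"
      by (simp only: e_def)
  qed
  then have "f = restrict (\<lambda>x. (1 / c) * minor n e (grad x) (hess x)) U"
    unfolding f using \<open>c \<noteq> 0\<close> by (intro restrict_ext) simp
  moreover have "restrict (\<lambda>x. (1 / c) * minor n e (grad x) (hess x)) U \<in> rhs"
  proof (intro ideal_mult ideal_rhs holomorphic_multi_const minor_in_rhs)
    show "e t \<in> {0..n} \<times> {1..n}" if "t \<le> n" for t
      using e[OF that] by (cases "e t") auto
  qed
  ultimately show "f \<in> rhs" by simp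
qed

lemma second_jacobian_subset: "I2 \<subseteq> rhs"
  unfolding second_jacobian_ideal_def by (rule genideal_minimal[OF ideal_rhs minor_gens_rhs])

section \<open>The converse inclusion\<close>

lemma minor_gens_carrier: "minor_gens \<subseteq> carrier R"
  using minor_gens_rhs ideal.Icarr[OF ideal_rhs] by blast

lemma ideal_I2: "ideal I2 R"
  unfolding second_jacobian_ideal_def by (rule genideal_ideal[OF minor_gens_carrier])

text \<open>Generators come from sets of column positions, while e is any sequence of pairs. If two
  pairs agree up to order, the minor is 0; otherwise the positions form a set, and rearranging the
  columns and halving the loops cost only a sign and a power of 2.\<close>

lemma minor_in_I2:
  assumes e: "\<And>t. t \<le> n \<Longrightarrow> e t \<in> {0..n} \<times> {1..n}"
  shows "restrict (\<lambda>x. minor n e (grad x) (hess x)) U \<in> I2"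
proof -
  let ?N = "n + ((n + 1) choose 2)"
  define s where "s t = (min (fst (e t)) (snd (e t)), max (fst (e t)) (snd (e t)))" for t
  have "\<exists>q<?N. jac2_cols n ! q = s t" if "t \<le> n" for t
  proof -
    have "s t \<in> set (jac2_cols n)"
      using e[OF that] by (auto simp: set_jac2_cols s_def)
    then show ?thesis by (simp add: in_set_conv_nth length_jac2_cols)
  qed
  then obtain q where q: "\<And>t. t \<le> n \<Longrightarrow> q t < ?N \<and> jac2_cols n ! q t = s t" by metis
  define c where "c = (\<Prod>t=0..n. dbl (e t))"
  let ?B = "\<lambda>x r k. jac2_entry idx F r (jac2_cols n ! k) x"
  have minor: "minor n e (grad x) (hess x) = c * sqdet n (\<lambda>r t. ?B x r (q t))" if x: "x \<in> U" for x
    unfolding minor_def c_def sqdet_scale_columns[symmetric]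
  proof (rule sqdet_cong)
    fix r t assume t: "t \<le> n"
    have "snd (e t) \<noteq> 0" using e[OF t] by (auto simp: mem_Times_iff)
    with col_entry_eq[OF this x, of r] q[OF t]
    show "col_entry (grad x) (hess x) r (e t) = dbl (e t) * ?B x r (q t)"
      by (simp only: s_def)
  qed
  show ?thesis
  proof (cases "inj_on q {0..n}")
    case False
    then obtain t t' where t: "t \<le> n" "t' \<le> n" "t \<noteq> t'" "q t = q t'" by (auto simp: inj_on_def)
    have "minor n e (grad x) (hess x) = 0" if "x \<in> U" for x
      using minor[OF that] sqdet_equal_columns[OF t(1,2,3), of "\<lambda>r t. ?B x r (q t)"] t(4) by simp
    then have "restrict (\<lambda>x. minor n e (grad x) (hess x)) U = restrict (\<lambda>_. 0) U"
      by (intro restrict_ext)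
    then show ?thesis using ideal_zero[OF ideal_I2] by simp
  next
    case True
    define J where "J = q ` {0..n}"
    have J: "J \<subseteq> {..<?N}" "card J = n + 1"
      using q True by (auto simp: J_def card_image)
    \<comment> \<open>The rank of \<open>q t\<close> in \<open>J\<close>, so the increasing
      enumeration \<open>pick J\<close> returns \<open>q t\<close> there; being the identity beyond
      n makes \<sigma> a permutation of {0..n}.\<close>
    define \<sigma> where "\<sigma> t = (if t \<le> n then card {a \<in> J. a < q t} else t)" for t
    have pick: "pick J (\<sigma> t) = q t" if "t \<le> n" for t
      using that by (simp add: \<sigma>_def J_def pick_card_in_set)
    have "\<sigma> permutes {0..n}"
    proof (rule bij_imp_permutes)
      have "inj_on \<sigma> {0..n}"
        using True pick by (intro inj_onI) (metis atLeastAtMost_iff inj_onD)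
      moreover have "\<sigma> ` {0..n} \<subseteq> {0..n}"
      proof safe
        fix t assume "t \<in> {0..n}"
        then have "{a \<in> J. a < q t} \<subset> J" by (auto simp: J_def)
        then have "card {a \<in> J. a < q t} < card J" by (intro psubset_card_mono) (auto simp: J_def)
        then show "\<sigma> t \<in> {0..n}" using \<open>t \<in> {0..n}\<close> J(2) by (simp add: \<sigma>_def)
      qed
      ultimately show "bij_betw \<sigma> {0..n} {0..n}"
        by (simp add: bij_betw_def endo_inj_surj)
    qed (simp add: \<sigma>_def)
    have "minor n e (grad x) (hess x) = c * of_int (sign \<sigma>) * Determinant.det (submatrix (jac2 n idx F x) UNIV J)"
      if x: "x \<in> U" for x
    proof -
      have "sqdet n (\<lambda>r t. ?B x r (q t)) = sqdet n (\<lambda>r t. ?B x r (pick J (\<sigma> t)))"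
        by (rule sqdet_cong) (simp add: pick)
      also have "\<dots> = of_int (sign \<sigma>) * sqdet n (\<lambda>r t. ?B x r (pick J t))"
        by (rule sqdet_permute_columns[OF \<open>\<sigma> permutes {0..n}\<close>])
      finally show ?thesis unfolding minor[OF x] submatrix_jac2[OF J] by (simp only: mult.assoc)
    qed
    then have "restrict (\<lambda>x. minor n e (grad x) (hess x)) U
        = restrict (\<lambda>x. c * of_int (sign \<sigma>) * Determinant.det (submatrix (jac2 n idx F x) UNIV J)) U"
      by (intro restrict_ext)
    moreover have "restrict (\<lambda>x. Determinant.det (submatrix (jac2 n idx F x) UNIV J)) U \<in> I2"
      unfolding second_jacobian_ideal_def using genideal_self[OF minor_gens_carrier] J by blast
    ultimately show ?thesis
      using ideal_mult[OF ideal_I2 holomorphic_multi_const] by simp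
  qed
qed

text \<open>Specialises the formal pair (y, h) to gradient and Hessian; the rule \<open>cong\<close>
  survives this because the Hessian is symmetric on U.\<close>

lemma minor_span_in_I2:
  "minor_span n P \<Longrightarrow> restrict (\<lambda>x. P (grad x) (hess x)) U \<in> I2"
proof (induction rule: minor_span.induct)
  case (minor e)
  then show ?case by (rule minor_in_I2)
next
  case (cong P P')
  have "restrict (\<lambda>x. P (grad x) (hess x)) U = restrict (\<lambda>x. P' (grad x) (hess x)) U"
    by (intro restrict_ext cong.hyps(2)) (rule hess_sym)
  with cong.IH show ?case by simp
next
  case zero
  show ?case by (rule ideal_zero[OF ideal_I2])
next
  case (add P P')
  show ?case by (rule ideal_add[OF ideal_I2 add.IH])
next
  case (scale P c)
  show ?case by (rule ideal_mult[OF ideal_I2 holomorphic_multi_const scale.IH])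
qed

lemma foldr_grad_gens:
  "set gs \<subseteq> grad_gens \<Longrightarrow> \<exists>\<alpha>. set_mset \<alpha> \<subseteq> {1..n} \<and> size \<alpha> = length gs \<and>
    foldr (\<otimes>\<^bsub>R\<^esub>) gs \<one>\<^bsub>R\<^esub> = restrict (\<lambda>x. monom_fun \<alpha> (grad x)) U"
proof (induction gs)
  case Nil
  show ?case by (intro exI[of _ "{#}"]) (simp add: holo_ring_def)
next
  case (Cons g gs)
  have "set gs \<subseteq> grad_gens" using Cons.prems by (simp only: list.set insert_subset)
  from Cons.IH[OF this] obtain \<alpha> where \<alpha>: "set_mset \<alpha> \<subseteq> {1..n}" "size \<alpha> = length gs"
    "foldr (\<otimes>\<^bsub>R\<^esub>) gs \<one>\<^bsub>R\<^esub> = restrict (\<lambda>x. monom_fun \<alpha> (grad x)) U"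
    by (elim exE conjE)
  have "g \<in> grad_gens" using Cons.prems by (simp only: list.set insert_subset)
  then obtain k where k: "k \<in> {1..n}" "g = restrict (partial idx k F) U" by blast
  show ?case
  proof (intro exI[of _ "add_mset k \<alpha>"] conjI)
    show "set_mset (add_mset k \<alpha>) \<subseteq> {1..n}" using \<alpha>(1) k(1) by simp
    show "size (add_mset k \<alpha>) = length (g # gs)" using \<alpha>(2) by simp
    have "foldr (\<otimes>\<^bsub>R\<^esub>) (g # gs) \<one>\<^bsub>R\<^esub> = restrict (partial idx k F) U \<otimes>\<^bsub>R\<^esub> restrict (\<lambda>x. monom_fun \<alpha> (grad x)) U"
      by (simp only: foldr.simps o_apply \<alpha>(3) k(2))
    then show "foldr (\<otimes>\<^bsub>R\<^esub>) (g # gs) \<one>\<^bsub>R\<^esub> = restrict (\<lambda>x. monom_fun (add_mset k \<alpha>) (grad x)) U"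
      by (simp only: holo_ring_mult_restrict image_mset_add_mset prod_mset.add_mset)
  qed
qed

lemma hom_poly_monom_fun: "set_mset \<alpha> \<subseteq> {1..n} \<Longrightarrow> hom_poly n (size \<alpha>) (monom_fun \<alpha>)"
  by (induction \<alpha>) (auto intro: hom_poly.const hom_poly.times)

lemma power_subset_I2: "ideal_power R I1 (n + 1) \<subseteq> I2"
  unfolding jacobian_ideal_def
proof (rule ideal_power_Idl_subset[OF ideal_I2 gens_carrier(1)])
  fix gs assume gs: "set gs \<subseteq> grad_gens" "length gs = n + 1"
  obtain \<alpha> where \<alpha>: "set_mset \<alpha> \<subseteq> {1..n}" "size \<alpha> = length gs"
    "foldr (\<otimes>\<^bsub>R\<^esub>) gs \<one>\<^bsub>R\<^esub> = restrict (\<lambda>x. monom_fun \<alpha> (grad x)) U"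
    using foldr_grad_gens[OF gs(1)] by (elim exE conjE)
  have "size \<alpha> = Suc n" using \<alpha>(2) gs(2) by simp
  \<comment> \<open>One variable is produced by the column (0, j), the other n by a forest.\<close>
  then obtain j \<beta> where \<beta>: "\<alpha> = add_mset j \<beta>" by (metis size_eq_Suc_imp_eq_union)
  have "minor_span n (\<lambda>y h. y j * monom_fun \<beta> y)"
    using \<alpha>(1) \<open>size \<alpha> = Suc n\<close> \<beta> by (intro minor_span_monomial) auto
  from minor_span_in_I2[OF this] show "foldr (\<otimes>\<^bsub>R\<^esub>) gs \<one>\<^bsub>R\<^esub> \<in> I2"
    by (simp add: \<alpha>(3) \<beta>)
qed

text \<open>Passing to the quotient of the second Jacobian ideal by a generator g of the Q ideal
  reduces the claim to monomials of degree n - 2 in the gradient, each multiplied by a single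
  Q_ij;kl.\<close>

lemma prod_subset_I2: "ideal_prod R (ideal_power R I1 (n - 2)) IQ \<subseteq> I2"
  unfolding Q_ideal_def
proof (rule ideal_prod_Idl_subset[OF ideal_I2 _ gens_carrier(2)])
  show "ideal_power R I1 (n - 2) \<subseteq> carrier R"
    by (rule subsetI) (rule ideal.Icarr[OF ideal_power_ideal[OF ideal_I1]])
  fix g assume g: "g \<in> Q_gens"
  then obtain i j k l where idx: "i \<in> {1..n}" "j \<in> {1..n}" "k \<in> {1..n}" "l \<in> {1..n}"
    and g_eq: "g = restrict (Q_fun idx F i j k l) U" by blast
  have gc: "g \<in> carrier R" using g gens_carrier(2) by blast
  show "ideal_power R I1 (n - 2) \<subseteq> {x \<in> carrier R. x \<otimes>\<^bsub>R\<^esub> g \<in> I2}"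
    unfolding jacobian_ideal_def
  proof (rule ideal_power_Idl_subset[OF colon_ideal[OF ideal_I2 gc] gens_carrier(1)])
    fix gs assume gs: "set gs \<subseteq> grad_gens" "length gs = n - 2"
    obtain \<alpha> where \<alpha>: "set_mset \<alpha> \<subseteq> {1..n}" "size \<alpha> = length gs"
      "foldr (\<otimes>\<^bsub>R\<^esub>) gs \<one>\<^bsub>R\<^esub> = restrict (\<lambda>x. monom_fun \<alpha> (grad x)) U"
      using foldr_grad_gens[OF gs(1)] by (elim exE conjE)
    have "foldr (\<otimes>\<^bsub>R\<^esub>) gs \<one>\<^bsub>R\<^esub> \<in> carrier R"
      using gs(1) gens_carrier(1) by (induction gs) auto
    moreover have "hom_poly n (n - 2) (monom_fun \<alpha>)"
      using hom_poly_monom_fun[OF \<alpha>(1)] \<alpha>(2) gs(2) by simp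
    from minor_span_in_I2[OF minor_span_Q[OF this idx]]
    have "foldr (\<otimes>\<^bsub>R\<^esub>) gs \<one>\<^bsub>R\<^esub> \<otimes>\<^bsub>R\<^esub> g \<in> I2"
      unfolding \<alpha>(3) g_eq holo_ring_mult_restrict Q_fun_eq .
    ultimately show "foldr (\<otimes>\<^bsub>R\<^esub>) gs \<one>\<^bsub>R\<^esub> \<in> {x \<in> carrier R. x \<otimes>\<^bsub>R\<^esub> g \<in> I2}" by blast
  qed
qed

lemma second_jacobian_ideal_eq: "I2 = rhs"
  using second_jacobian_subset
    set_add_subset[OF ideal_power_ideal[OF ideal_I1] ideal_prod_IQ ideal_I2 power_subset_I2 prod_subset_I2]
  by (rule equalityI)

end

theorem theorem4p3:
  fixes n :: nat
    and idx :: "nat \<Rightarrow> 'n::finite"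
    and U :: "(complex ^ 'n) set"
    and F :: "complex ^ 'n \<Rightarrow> complex"
  assumes "n \<ge> 2"
    and "bij_betw idx {1..n} UNIV"
    and "open U"
    and "holomorphic_multi F U"
  shows "second_jacobian_ideal n idx U F =
           ideal_power (holo_ring U) (jacobian_ideal n idx U F) (n + 1)
           <+>\<^bsub>holo_ring U\<^esub>
           ideal_prod (holo_ring U)
             (ideal_power (holo_ring U) (jacobian_ideal n idx U F) (n - 2))
             (Q_ideal n idx U F)"
proof -
  interpret holomorphic_function n idx U F
    using assms by unfold_locales
  show ?thesis by (rule second_jacobian_ideal_eq)
qed

end
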